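(* Let $\mathbb{F}$ be a field with $\operatorname{char}\mathbb{F}\neq2$. Let $S=W_Q$ be the generic quantum torus, that is, the skew Laurent polynomial ring $\mathbb{F}[y^{\pm1},Q^{\pm1}][x^{\pm1};\alpha]$, where $\alpha$ is the $\mathbb{F}$-automorphism with $\alpha(y)=Qy$ and $\alpha(Q)=Q$, and let $\theta$ be the $\mathbb{F}$-automorphism of $S$ such that $\theta(x)=x^{-1}$, $\theta(y)=y^{-1}$ and $\theta(Q)=Q$. Let $T$ be the $\mathbb{F}$-algebra generated by $Q$, $Q^{-1}$, $x_1,x_2$ and $x_3$ subject to the relations \begin{align*} x_iQ&=Qx_i,\quad x_iQ^{-1}=Q^{-1}x_i\quad\text{for } i=1,2,3,\qquad QQ^{-1}=Q^{-1}Q=1,\\ x_1x_2&=Qx_2x_1+(1-Q^2)x_3,\\ x_2x_3&=Qx_3x_2+(Q^{-1}-Q)x_1,\\ x_1x_3&=Q^{-1}x_3x_1+(1-Q^{-2})x_2, \end{align*} and let $g=x_3x_2x_1-Qx_3^2-Q^{-2}x_2^2-x_1^2+2(1+Q^{-2})$, a central element of $T$. Then the fixed ring $S^\theta$ is isomorphic to $T/gT$.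
   Context: In the skew Laurent polynomial ring $R[x^{\pm1};\alpha]$ multiplication is determined by $xr=\alpha(r)x$ for $r\in R$; thus in $W_Q$ one has $xy=Qyx$ and $Q$ is central. $S^\theta$ is the subring of elements fixed by $\theta$; isomorphism is as $\mathbb{F}$-algebras. *)

theory Defs
  imports
    "HOL-Library.Poly_Mapping"
    "HOL-Library.Product_Plus"
    "HOL-Algebra.QuotRing"
    "HOL-Algebra.Module"
begin

section \<open>Algebras\<close>

text \<open>
  An algebra is given by a record of type \<open>('k, 'b) module\<close>: its ring operations together with
  the scalar multiplication. (The locale \<^locale>\<open>algebra\<close> of the library covers commutative
  algebras only.)
\<close>

definition alg_iso ::
  "('k, 'b, 'm) module_scheme \<Rightarrow> ('k, 'c, 'n) module_scheme \<Rightarrow> ('b \<Rightarrow> 'c) set" where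
  "alg_iso A B =
     {h \<in> ring_iso A B. \<forall>c. \<forall>a\<in>carrier A. h (c \<odot>\<^bsub>A\<^esub> a) = c \<odot>\<^bsub>B\<^esub> h a}"

definition fixed_alg :: "('k, 'b) module \<Rightarrow> ('b \<Rightarrow> 'b) \<Rightarrow> ('k, 'b) module" where
  "fixed_alg A \<theta> = A\<lparr>carrier := {a \<in> carrier A. \<theta> a = a}\<rparr>"

text \<open>
  The ring structure is that of \<^const>\<open>FactRing\<close>, and \<open>c \<odot> (I + a) = I + c \<odot> a\<close>.
\<close>

definition quot_alg :: "('k, 'b, 'm) module_scheme \<Rightarrow> 'b set \<Rightarrow> ('k, 'b set) module" where
  "quot_alg A I =
     \<lparr>carrier = carrier (A Quot I), mult = mult (A Quot I), one = one (A Quot I),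
      zero = zero (A Quot I), add = add (A Quot I),
      smult = (\<lambda>c X. \<Union>a\<in>X. I +>\<^bsub>A\<^esub> (c \<odot>\<^bsub>A\<^esub> a))\<rparr>"

text \<open>
  The monoid algebra over \<open>'k\<close> of an additively written, possibly non-commutative monoid \<open>'m\<close>.
\<close>

definition monoid_alg :: "('k::comm_ring_1, 'm::monoid_add \<Rightarrow>\<^sub>0 'k) module" where
  "monoid_alg =
     \<lparr>carrier = UNIV, mult = (*), one = 1, zero = 0, add = (+),
      smult = (\<lambda>c. Poly_Mapping.map ((*) c))\<rparr>"


section \<open>The generic quantum torus\<close>

text \<open>
  \<open>\<bbbF>[y\<^sup>\<plusminus>\<^sup>1, Q\<^sup>\<plusminus>\<^sup>1]\<close> is the group algebra of \<open>\<int> \<times> \<int>\<close>, the pair \<open>(i, j)\<close> standing for \<open>y\<^sup>i Q\<^sup>j\<close>.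
\<close>

type_synonym 'k laurent2 = "int \<times> int \<Rightarrow>\<^sub>0 'k"

abbreviation laurent2_alg :: "('k::field, 'k laurent2) module" where
  "laurent2_alg \<equiv> monoid_alg"

definition y_L :: "'k::field laurent2" where "y_L = Poly_Mapping.single (1, 0) 1"
definition y_inv_L :: "'k::field laurent2" where "y_inv_L = Poly_Mapping.single (-1, 0) 1"
definition Q_L :: "'k::field laurent2" where "Q_L = Poly_Mapping.single (0, 1) 1"

definition int_iter :: "('r \<Rightarrow> 'r) \<Rightarrow> int \<Rightarrow> 'r \<Rightarrow> 'r" where
  "int_iter \<alpha> i = (if 0 \<le> i then \<alpha> ^^ nat i else (inv_into UNIV \<alpha>) ^^ nat (- i))"

text \<open>
  An element \<open>f\<close> of the skew Laurent polynomial ring \<open>R[x\<^sup>\<plusminus>\<^sup>1; \<alpha>]\<close> stands for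
  \<open>\<Sum>i. f\<^sub>i x\<^sup>i\<close>, with coefficients on the left; thus \<open>x r = \<alpha>(r) x\<close> gives
  \<open>(r x\<^sup>i) (s x\<^sup>j) = r \<alpha>\<^sup>i(s) x\<^sup>i\<^sup>+\<^sup>j\<close>.
\<close>

definition skew_mult ::
  "('r::ring_1 \<Rightarrow> 'r) \<Rightarrow> (int \<Rightarrow>\<^sub>0 'r) \<Rightarrow> (int \<Rightarrow>\<^sub>0 'r) \<Rightarrow> (int \<Rightarrow>\<^sub>0 'r)" where
  "skew_mult \<alpha> f g =
     (\<Sum>i\<in>Poly_Mapping.keys f. \<Sum>j\<in>Poly_Mapping.keys g.
        Poly_Mapping.single (i + j)
          (Poly_Mapping.lookup f i * int_iter \<alpha> i (Poly_Mapping.lookup g j)))"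

definition skew_laurent_alg ::
  "('k \<Rightarrow> 'r \<Rightarrow> 'r) \<Rightarrow> ('r::ring_1 \<Rightarrow> 'r) \<Rightarrow> ('k, int \<Rightarrow>\<^sub>0 'r) module" where
  "skew_laurent_alg scale \<alpha> =
     \<lparr>carrier = UNIV, mult = skew_mult \<alpha>, one = Poly_Mapping.single 0 1, zero = 0, add = (+),
      smult = (\<lambda>c. Poly_Mapping.map (scale c))\<rparr>"

text \<open>
  The generic quantum torus \<open>W\<^sub>Q\<close> if \<open>\<alpha>\<close> is the automorphism with \<open>\<alpha>(y) = Q y\<close> and
  \<open>\<alpha>(Q) = Q\<close>.
\<close>

definition quantum_torus ::
  "('k::field laurent2 \<Rightarrow> 'k laurent2) \<Rightarrow> ('k, int \<Rightarrow>\<^sub>0 'k laurent2) module" where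
  "quantum_torus \<alpha> = skew_laurent_alg (smult laurent2_alg) \<alpha>"

definition x_S :: "int \<Rightarrow>\<^sub>0 'k::field laurent2" where "x_S = Poly_Mapping.single 1 1"
definition x_inv_S :: "int \<Rightarrow>\<^sub>0 'k::field laurent2" where "x_inv_S = Poly_Mapping.single (-1) 1"
definition y_S :: "int \<Rightarrow>\<^sub>0 'k::field laurent2" where "y_S = Poly_Mapping.single 0 y_L"
definition y_inv_S :: "int \<Rightarrow>\<^sub>0 'k::field laurent2" where "y_inv_S = Poly_Mapping.single 0 y_inv_L"
definition Q_S :: "int \<Rightarrow>\<^sub>0 'k::field laurent2" where "Q_S = Poly_Mapping.single 0 Q_L"


section \<open>The algebra \<open>T\<close>\<close>

text \<open>
  With concatenation as addition, lists form the free monoid, and the free algebra on \<open>'x\<close> is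
  its monoid algebra.
\<close>

instantiation list :: (type) monoid_add
begin

definition zero_list :: "'a list" where "zero_list = []"
definition plus_list :: "'a list \<Rightarrow> 'a list \<Rightarrow> 'a list" where "plus_list = (@)"

instance by standard (simp_all add: zero_list_def plus_list_def)

end

type_synonym ('x, 'k) free_alg = "'x list \<Rightarrow>\<^sub>0 'k"

definition var :: "'x \<Rightarrow> ('x, 'k::field) free_alg" where
  "var v = Poly_Mapping.single [v] 1"

definition presented_alg ::
  "('x, 'k::field) free_alg set \<Rightarrow> ('k, ('x, 'k) free_alg set) module" where
  "presented_alg rels = quot_alg monoid_alg (genideal monoid_alg rels)"

datatype T_gen = GQ | GQinv | GX1 | GX2 | GX3

text \<open>Each relation \<open>l = r\<close> is entered as the relator \<open>l - r\<close>.\<close>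

definition T_rels :: "(T_gen, 'k::field) free_alg set" where
  "T_rels =
    (let Q = var GQ; Q' = var GQinv; x\<^sub>1 = var GX1; x\<^sub>2 = var GX2; x\<^sub>3 = var GX3 in
     {x\<^sub>1 * Q - Q * x\<^sub>1, x\<^sub>2 * Q - Q * x\<^sub>2, x\<^sub>3 * Q - Q * x\<^sub>3,
      x\<^sub>1 * Q' - Q' * x\<^sub>1, x\<^sub>2 * Q' - Q' * x\<^sub>2, x\<^sub>3 * Q' - Q' * x\<^sub>3,
      Q * Q' - 1, Q' * Q - 1,
      x\<^sub>1 * x\<^sub>2 - (Q * x\<^sub>2 * x\<^sub>1 + (1 - Q\<^sup>2) * x\<^sub>3),
      x\<^sub>2 * x\<^sub>3 - (Q * x\<^sub>3 * x\<^sub>2 + (Q' - Q) * x\<^sub>1),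
      x\<^sub>1 * x\<^sub>3 - (Q' * x\<^sub>3 * x\<^sub>1 + (1 - Q'\<^sup>2) * x\<^sub>2)})"

definition T_alg :: "('k::field, (T_gen, 'k) free_alg set) module" where
  "T_alg = presented_alg T_rels"

text \<open>The element of \<open>T\<close> represented by an element of the free algebra.\<close>

definition T_class :: "(T_gen, 'k::field) free_alg \<Rightarrow> (T_gen, 'k) free_alg set" where
  "T_class f = genideal monoid_alg T_rels +>\<^bsub>monoid_alg\<^esub> f"

definition g_T :: "(T_gen, 'k::field) free_alg set" where
  "g_T =
    (let Q = var GQ; Q' = var GQinv; x\<^sub>1 = var GX1; x\<^sub>2 = var GX2; x\<^sub>3 = var GX3 in
     T_class (x\<^sub>3 * x\<^sub>2 * x\<^sub>1 - Q * x\<^sub>3\<^sup>2 - Q'\<^sup>2 * x\<^sub>2\<^sup>2 - x\<^sub>1\<^sup>2 + 2 * (1 + Q'\<^sup>2)))"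

definition gT :: "(T_gen, 'k::field) free_alg set set" where
  "gT = {g_T \<otimes>\<^bsub>T_alg\<^esub> t | t. t \<in> carrier T_alg}"

end

theory Submission
  imports Defs
begin

text \<open>
  The homomorphism \<open>\<phi>\<close> with \<open>x\<^sub>1 \<mapsto> x + x\<inverse>\<close>, \<open>x\<^sub>2 \<mapsto> y + y\<inverse>\<close>, \<open>x\<^sub>3 \<mapsto> Q\<inverse> (y\<inverse> x + y x\<inverse>)\<close> maps \<open>T\<close> to
  \<open>S\<^sup>\<theta>\<close> and kills \<open>g\<close>. In \<open>T\<close> there is a Chebyshev-like family \<open>E k l\<close> lifting \<open>y\<^sup>k x\<^sup>l + y\<^sup>-\<^sup>k x\<^sup>-\<^sup>l\<close>. The
  product-to-sum formulas for \<open>x\<^sub>i E k l\<close>, which hold in the torus, already hold in \<open>T\<close> modulo \<open>g\<close>; they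
  are second-order recurrences in \<open>k\<close> and \<open>l\<close>, and \<open>g\<close> enters as one of the initial values. Therefore
  the linear map \<open>\<psi>\<close> sending \<open>y\<^sup>k x\<^sup>l\<close> to \<open>E k l / 2\<close> satisfies \<open>\<psi> (\<phi> f s) \<equiv> f \<psi> s\<close> modulo \<open>g\<close>. With
  \<open>s = 1\<close> this shows that the kernel of \<open>\<phi>\<close> is \<open>gT\<close>, and \<open>\<phi> (\<psi> s) = (s + \<theta> s) / 2\<close> shows that \<open>\<phi>\<close> is onto \<open>S\<^sup>\<theta>\<close>.
\<close>

section \<open>Two-sided recurrences\<close>

lemma int_iter_0 [simp]: "int_iter f 0 = id"
  by (simp add: int_iter_def)

lemma int_iter_plus1:
  assumes "bij f"
  shows "int_iter f (n + 1) x = f (int_iter f n x)"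
proof (cases "0 \<le> n")
  case True
  then have "nat (n + 1) = Suc (nat n)" by simp
  with True show ?thesis by (simp add: int_iter_def)
next
  case False
  then have *: "nat (- n) = Suc (nat (- (n + 1)))" by simp
  show ?thesis
  proof (cases "n = - 1")
    case True
    with assms show ?thesis by (simp add: int_iter_def bij_is_surj surj_f_inv_f)
  next
    case neq: False
    with False * assms show ?thesis by (simp add: int_iter_def bij_is_surj surj_f_inv_f)
  qed
qed

text \<open>The recurrences below have order two, so the induction carries the pair
  \<open>P n\<close> and \<open>P (n + 1)\<close>.\<close>

lemma int_two_step_induct:
  fixes P :: "int \<Rightarrow> bool"
  assumes base: "P m" "P (m + 1)"
    and up: "\<And>n. P (n - 1) \<Longrightarrow> P n \<Longrightarrow> P (n + 1)"
    and down: "\<And>n. P (n + 1) \<Longrightarrow> P n \<Longrightarrow> P (n - 1)"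
  shows "P n"
proof -
  have "P n \<and> P (n + 1)"
  proof (induction n rule: int_induct[of _ m])
    case base
    show ?case using assms(1,2) by simp
  next
    case (step1 i)
    then show ?case using up[of "i + 1"] by (simp add: algebra_simps)
  next
    case (step2 i)
    then show ?case using down[of i] by (simp add: algebra_simps)
  qed
  then show ?thesis ..
qed

text \<open>Iterating a map on pairs of consecutive terms gives negative indices as well:
  \<open>int_iter\<close> then uses the inverse map, which exists as soon as \<open>v\<close> is a
  unit.\<close>

definition recur :: "'a::ring_1 \<Rightarrow> 'a \<Rightarrow> 'a \<Rightarrow> 'a \<Rightarrow> int \<Rightarrow> 'a" where
  "recur u v a b n = fst (int_iter (\<lambda>(a, b). (b, u * b - v * a)) n (a, b))"

lemma recur_props:
  fixes u v v' a b :: "'a::ring_1"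
  assumes "v * v' = 1" "v' * v = 1"
  shows recur_0: "recur u v a b 0 = a" and recur_1: "recur u v a b 1 = b"
    and recur_step: "recur u v a b (n + 1) = u * recur u v a b n - v * recur u v a b (n - 1)"
proof -
  let ?f = "\<lambda>(a, b). (b, u * b - v * a)"
  let ?s = "\<lambda>n. int_iter ?f n (a, b)"
  have v: "v * (v' * x) = x" "v' * (v * x) = x" for x
    using assms by (simp_all flip: mult.assoc)
  have bij: "bij ?f"
    \<comment> \<open>The inverse recovers the earlier term by solving the recurrence for
      it.\<close>
    by (rule bij_betw_byWitness[where f' = "\<lambda>(a, b). (v' * (u * a - b), a)"])
      (auto simp: v algebra_simps)
  note iter = int_iter_plus1[OF bij]
  show "recur u v a b 0 = a" by (simp add: recur_def)
  show "recur u v a b 1 = b" using iter[of 0 "(a, b)"] by (simp add: recur_def)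
  have snd: "snd (?s n) = fst (?s (n + 1))" for n
    by (simp add: iter case_prod_beta)
  have "fst (?s (n + 1)) = snd (?s n)" by (simp add: snd)
  also have "?s n = ?f (?s (n - 1))" using iter[of "n - 1" "(a, b)"] by simp
  also have "snd (?f (?s (n - 1))) = u * snd (?s (n - 1)) - v * fst (?s (n - 1))"
    by (simp add: case_prod_beta)
  finally show "recur u v a b (n + 1) = u * recur u v a b n - v * recur u v a b (n - 1)"
    by (simp add: recur_def snd)
qed

section \<open>Chebyshev-type elements\<close>

text \<open>Stated for elements of any ring, so that one set of definitions and identities serves
  both the torus and \<open>T\<close>.\<close>

locale T_relations =
  fixes Q Q' x1 x2 x3 :: "'a::ring_1"
  assumes x1_Q: "x1 * Q = Q * x1" and x2_Q: "x2 * Q = Q * x2" and x3_Q: "x3 * Q = Q * x3"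
    and x1_Q': "x1 * Q' = Q' * x1" and x2_Q': "x2 * Q' = Q' * x2" and x3_Q': "x3 * Q' = Q' * x3"
    and Q_Q': "Q * Q' = 1" and Q'_Q: "Q' * Q = 1"
    and x1_x2: "x1 * x2 = Q * x2 * x1 + (1 - Q\<^sup>2) * x3"
    and x2_x3: "x2 * x3 = Q * x3 * x2 + (Q' - Q) * x1"
    and x1_x3: "x1 * x3 = Q' * x3 * x1 + (1 - Q'\<^sup>2) * x2"
begin

section \<open>Normal ordering and the centrality of g\<close>

definition g where "g = x3 * x2 * x1 - Q * x3\<^sup>2 - Q'\<^sup>2 * x2\<^sup>2 - x1\<^sup>2 + 2 * (1 + Q'\<^sup>2)"

text \<open>A free right factor lets each relation act inside right-nested products. Read from left
  to right, the rules move \<open>Q\<close> and \<open>Q'\<close> to the front and sort the rest as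
  \<open>x3\<close>, \<open>x2\<close>, \<open>x1\<close>.\<close>

lemma left_rules:
  "x1 * (Q * a) = Q * (x1 * a)" "x2 * (Q * a) = Q * (x2 * a)" "x3 * (Q * a) = Q * (x3 * a)"
  "x1 * (Q' * a) = Q' * (x1 * a)" "x2 * (Q' * a) = Q' * (x2 * a)" "x3 * (Q' * a) = Q' * (x3 * a)"
  "Q * (Q' * a) = a" "Q' * (Q * a) = a"
  "x1 * (x2 * a) = Q * (x2 * (x1 * a)) + (x3 * a - Q * (Q * (x3 * a)))"
  "x2 * (x3 * a) = Q * (x3 * (x2 * a)) + (Q' * (x1 * a) - Q * (x1 * a))"
  "x1 * (x3 * a) = Q' * (x3 * (x1 * a)) + (x2 * a - Q' * (Q' * (x2 * a)))"
  by (simp_all only: mult.assoc[symmetric] x1_Q x2_Q x3_Q x1_Q' x2_Q' x3_Q' Q_Q' Q'_Q x1_x2 x2_x3 x1_x3)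
    (simp_all add: algebra_simps power2_eq_square)

lemma rules:
  "x1 * x2 = Q * (x2 * x1) + (x3 - Q * (Q * x3))"
  "x2 * x3 = Q * (x3 * x2) + (Q' * x1 - Q * x1)"
  "x1 * x3 = Q' * (x3 * x1) + (x2 - Q' * (Q' * x2))"
  using left_rules[of 1] by simp_all

lemmas normal_order = x1_Q x2_Q x3_Q x1_Q' x2_Q' x3_Q' Q_Q' Q'_Q left_rules rules
  mult_2 mult_2_right power2_eq_square mult.assoc distrib_left distrib_right right_diff_distrib left_diff_distrib

text \<open>Normal ordering brings both sides to the same expression. With the four lemmas that
  follow, \<open>g\<close> commutes with all five generators.\<close>

lemma g_x1: "g * x1 = x1 * g"
  unfolding g_def by (simp add: normal_order)
lemma g_x2: "g * x2 = x2 * g"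
  unfolding g_def by (simp add: normal_order)
lemma g_x3: "g * x3 = x3 * g"
  unfolding g_def by (simp add: normal_order)
lemma g_Q: "g * Q = Q * g"
  unfolding g_def by (simp add: normal_order)
lemma g_Q': "g * Q' = Q' * g"
  unfolding g_def by (simp add: normal_order)

section \<open>Integer powers of Q\<close>

definition qpow :: "int \<Rightarrow> 'a" where
  "qpow k = (if 0 \<le> k then Q ^ nat k else Q' ^ nat (- k))"

lemma qpow_0 [simp]: "qpow 0 = 1"
  by (simp add: qpow_def)

lemma qpow_plus1: "qpow (k + 1) = Q * qpow k"
proof (cases "0 \<le> k")
  case True
  then have "nat (k + 1) = Suc (nat k)" by simp
  with True show ?thesis by (simp add: qpow_def)
next
  case False
  then have *: "nat (- k) = Suc (nat (- (k + 1)))" by simp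
  show ?thesis
    by (cases "k = - 1") (use False * in \<open>simp_all add: qpow_def left_rules Q_Q'\<close>)
qed

lemma qpow_minus1: "qpow (k - 1) = Q' * qpow k"
  using qpow_plus1[of "k - 1"] by (simp add: left_rules)

lemma qpow_neg: "qpow (1 - k) = Q * qpow (- k)" "qpow (- k - 1) = Q' * qpow (- k)"
  using qpow_plus1[of "- k"] qpow_minus1[of "- k"] by (simp_all add: algebra_simps)

lemma qpow_1 [simp]: "qpow 1 = Q" "qpow (-1) = Q'"
  using qpow_plus1[of 0] qpow_minus1[of 0] by simp_all

lemma qpow_commute:
  assumes "a * Q = Q * a" "a * Q' = Q' * a"
  shows "a * qpow k = qpow k * a"
  unfolding qpow_def using assms by (simp add: power_commuting_commutes)

lemmas qpow_x = qpow_commute[OF x1_Q x1_Q'] qpow_commute[OF x2_Q x2_Q'] qpow_commute[OF x3_Q x3_Q']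

lemma qpow_left:
  "x1 * (qpow k * a) = qpow k * (x1 * a)" "x2 * (qpow k * a) = qpow k * (x2 * a)"
  "x3 * (qpow k * a) = qpow k * (x3 * a)"
  "Q * (qpow k * a) = qpow k * (Q * a)" "Q' * (qpow k * a) = qpow k * (Q' * a)"
  by (simp_all add: qpow_x qpow_commute[of Q] qpow_commute[of Q'] Q_Q' Q'_Q flip: mult.assoc)

lemma qpow_add: "qpow (k + l) = qpow k * qpow l"
proof (induction l rule: int_induct[of _ 0])
  case base
  show ?case by simp
next
  case (step1 l)
  then show ?case unfolding qpow_plus1 add.assoc[symmetric] by (simp add: qpow_left)
next
  case (step2 l)
  then show ?case unfolding qpow_minus1 add_diff_eq by (simp add: qpow_left)
qed

lemma qpow_diff: "qpow (k - l) = qpow k * qpow (- l)"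
  using qpow_add[of k "- l"] by simp

section \<open>The elements E k l and their recurrences\<close>

definition E0 :: "int \<Rightarrow> 'a" where
  "E0 = recur x1 1 2 x1"

text \<open>Lifts y x^l + y^-1 x^-l. Since xy = Qyx, multiplying this by x + x^-1 brings in
  \<open>Q\<close> and \<open>Q'\<close>, and solving for the next term gives the recurrence. The
  shift by one puts the starting values at l = -1 and l = 0, where the element is
  \<open>Q * x3\<close> and \<open>x2\<close>.\<close>

definition E1 :: "int \<Rightarrow> 'a" where
  "E1 l = recur (Q' * x1) (Q' * Q') (Q * x3) x2 (l + 1)"

definition E :: "int \<Rightarrow> int \<Rightarrow> 'a" where
  "E k l = recur x2 1 (E0 l) (E1 l) k"

lemma E0_rec: "E0 0 = 2" "E0 1 = x1" "E0 (l + 1) = x1 * E0 l - E0 (l - 1)"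
  unfolding E0_def using recur_props[of 1 1] by simp_all

lemma E1_rec: "E1 (- 1) = Q * x3" "E1 0 = x2" "E1 (l + 1) = Q' * x1 * E1 l - Q' * (Q' * E1 (l - 1))"
proof -
  have "(Q' * Q') * (Q * Q) = 1" "(Q * Q) * (Q' * Q') = 1"
    by (simp_all add: normal_order)
  note r = recur_props[OF this, of "Q' * x1" "Q * x3" x2]
  show "E1 (- 1) = Q * x3" "E1 0 = x2" using r by (simp_all add: E1_def)
  show "E1 (l + 1) = Q' * x1 * E1 l - Q' * (Q' * E1 (l - 1))"
    using r(3)[of "l + 1"] by (simp add: E1_def mult.assoc)
qed

lemma E_rec: "E 0 l = E0 l" "E 1 l = E1 l" "E (k + 1) l = x2 * E k l - E (k - 1) l"
  unfolding E_def using recur_props[of 1 1] by simp_all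

lemma E_rec_down: "E (k - 1) l = x2 * E k l - E (k + 1) l"
  by (simp add: E_rec)

lemma x1_E0: "x1 * E0 l = E0 (l + 1) + E0 (l - 1)"
  by (simp add: E0_rec)

lemma x1_E1: "x1 * E1 l = Q * E1 (l + 1) + Q' * E1 (l - 1)"
  by (simp add: E1_rec normal_order)

lemma E0_down: "E0 (l - 1) = x1 * E0 l - E0 (l + 1)"
  by (simp add: x1_E0)

lemma E1_down: "E1 (l - 1) = Q * (x1 * E1 l) - Q * (Q * E1 (l + 1))"
  unfolding x1_E1 by (simp add: normal_order)

section \<open>Product-to-sum formulas modulo g\<close>

definition gI :: "'a set" where "gI = range ((*) g)"

lemma gI_I: "g * t \<in> gI"
  by (simp add: gI_def)

lemma gI_0 [simp]: "0 \<in> gI"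
  using gI_I[of 0] by simp

lemma gI_add: "a \<in> gI \<Longrightarrow> b \<in> gI \<Longrightarrow> a + b \<in> gI"
  unfolding gI_def by (auto simp flip: distrib_left)

lemma gI_diff: "a \<in> gI \<Longrightarrow> b \<in> gI \<Longrightarrow> a - b \<in> gI"
  unfolding gI_def by (auto simp flip: right_diff_distrib)

lemma gI_commuting:
  assumes "c * g = g * c" "a \<in> gI"
  shows "c * a \<in> gI"
proof -
  from assms(2) obtain t where "a = g * t" by (auto simp: gI_def)
  then have "c * a = g * (c * t)" using assms(1) by (metis mult.assoc)
  then show ?thesis by (simp add: gI_I)
qed

lemmas gI_left = gI_commuting[OF g_x1[symmetric]] gI_commuting[OF g_x2[symmetric]]
  gI_commuting[OF g_x3[symmetric]] gI_commuting[OF g_Q[symmetric]] gI_commuting[OF g_Q'[symmetric]]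

text \<open>\<open>R1\<close> and \<open>R3\<close> are the defects of the product-to-sum formulas for \<open>x1\<close> and \<open>Q x3\<close>.\<close>

definition R1 where
  "R1 k l = x1 * E k l - qpow k * E k (l + 1) - qpow (- k) * E k (l - 1)"

definition R3 where
  "R3 k l = Q * x3 * E k l - qpow k * E (k - 1) (l + 1) - qpow (- k) * E (k + 1) (l - 1)"

text \<open>For k = 0 and k = 1 the formula for \<open>x1\<close> is the recurrence in l that
  defines \<open>E0\<close> and \<open>E1\<close>, so it holds exactly.\<close>

lemma R1_0: "R1 0 l = 0" and R1_1: "R1 1 l = 0"
  by (simp_all add: R1_def E_rec x1_E0 x1_E1)

text \<open>As a sequence in l the defect satisfies a homogeneous recurrence of order two with unit
  coefficients \<open>Q\<close> and \<open>Q'\<close>, so two neighbouring zeros propagate in both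
  directions.\<close>

lemma R3_0: "R3 0 l = 0"
proof -
  have R3: "R3 0 l = Q * (x3 * E0 l) - x2 * E0 (l + 1) + E1 (l + 1) - E1 (l - 1)" for l
    using E_rec_down[of 0 "l + 1"] by (simp add: R3_def E_rec mult.assoc)
  have step: "x1 * R3 0 l = Q * R3 0 (l + 1) + Q' * R3 0 (l - 1)" for l
    unfolding R3 using x1_E0[of l] x1_E0[of "l + 1"] x1_E1[of "l + 1"] x1_E1[of "l - 1"]
    by (simp add: normal_order)
  show ?thesis
  \<comment> \<open>Started at -1 because \<open>E1\<close> has its prescribed values at -1 and 0,
    so that few further terms must be computed.\<close>
  proof (induction l rule: int_two_step_induct[of _ "-1"])
    case 1
    show ?case using E0_rec(3)[of 0] E1_down[of "-1"]
      by (simp add: R3 E0_rec E1_rec normal_order)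
  next
    case 2
    show ?case using E1_rec(3)[of 0]
      by (simp add: R3 E0_rec E1_rec normal_order)
  next
    case (3 n)
    then have "Q * R3 0 (n + 1) = 0" using step[of n] by simp
    then show ?case by (metis left_rules(8) mult_zero_right)
  next
    case (4 n)
    then have "Q' * R3 0 (n - 1) = 0" using step[of n] by simp
    then show ?case by (metis left_rules(7) mult_zero_right)
  qed
qed

text \<open>The scheme is that of k = 0, but the starting value at l = -1 is -gQ. This is the
  initial value through which \<open>g\<close> enters; the recurrence in l then stays among the
  multiples of \<open>g\<close>.\<close>

lemma R3_1: "R3 1 l \<in> gI"
proof -
  have R3: "R3 1 l = Q * (x3 * E1 l) - Q * E0 (l + 1) - Q' * (x2 * E1 (l - 1)) + Q' * E0 (l - 1)" for l
    using E_rec(3)[of 1 "l - 1"] by (simp add: R3_def E_rec normal_order)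
  have step: "x1 * R3 1 l = R3 1 (l + 1) + R3 1 (l - 1)" for l
    unfolding R3 using x1_E0[of "l + 1"] x1_E0[of "l - 1"] x1_E1[of "l"] x1_E1[of "l - 1"]
    by (simp add: normal_order)
  show ?thesis
  proof (induction l rule: int_two_step_induct[of _ "-1"])
    case 1
    have "R3 1 (- 1) = g * (- Q)"
      using E0_down[of 0] E0_down[of "-1"] E1_down[of "-1"]
      by (simp add: R3 E0_rec E1_rec g_def normal_order)
    \<comment> \<open>\<open>mult_minus_right\<close> would pull out the sign and destroy the form
      \<open>g * t\<close> expected by \<open>gI_I\<close>.\<close>
    then show ?case by (simp add: gI_I del: mult_minus_right)
  next
    case 2
    show ?case using E0_rec(3)[of 0] by (simp add: R3 E0_rec E1_rec normal_order)
  next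
    case (3 n)
    have "R3 1 (n + 1) = x1 * R3 1 n - R3 1 (n - 1)" using step[of n] by simp
    then show ?case using 3 by (simp add: gI_diff gI_left)
  next
    case (4 n)
    have "R3 1 (n - 1) = x1 * R3 1 n - R3 1 (n + 1)" using step[of n] by simp
    then show ?case using 4 by (simp add: gI_diff gI_left)
  qed
qed

text \<open>Expand \<open>E (k + 1) l\<close> as \<open>x2 * E k l - E (k - 1) l\<close>. Moving
  \<open>x1\<close> past this \<open>x2\<close> produces a term in \<open>x3\<close>, and moving
  \<open>x3\<close> past it a term in \<open>x1\<close>. The two defects thus satisfy a coupled
  recurrence in k and have to be treated together.\<close>

lemma R1_step: "R1 (k + 1) l + R1 (k - 1) l = Q * x2 * R1 k l + (Q' - Q) * R3 k l"
  by (simp add: R1_def R3_def E_rec(3) qpow_plus1 qpow_minus1 qpow_neg normal_order qpow_left)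

lemma R3_step: "R3 (k + 1) l + R3 (k - 1) l = Q' * x2 * R3 k l - (Q' - Q) * R1 k l"
proof -
  \<comment> \<open>\<open>R3\<close> at k + 1 and k - 1 reaches the indices k + 2 and k - 2, which
    one more step of the recurrence reduces.\<close>
  have E: "E (2 + k) m = x2 * E (k + 1) m - E k m" "E (k - 2) m = x2 * E (k - 1) m - E k m" for m
    using E_rec(3)[of "k + 1" m] E_rec_down[of "k - 1" m] by (simp_all add: add.commute)
  show ?thesis
    by (simp add: R1_def R3_def E E_rec(3) qpow_plus1 qpow_minus1 qpow_neg normal_order qpow_left)
qed

lemma R1_R3_gI: "R1 k l \<in> gI \<and> R3 k l \<in> gI"
proof (induction k rule: int_two_step_induct[of _ 0])
  case 1
  show ?case by (simp add: R1_0 R3_0)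
next
  case 2
  show ?case by (simp add: R1_1 R3_1)
next
  case (3 n)
  have "R1 (n + 1) l = Q * (x2 * R1 n l) + Q' * R3 n l - Q * R3 n l - R1 (n - 1) l"
    "R3 (n + 1) l = Q' * (x2 * R3 n l) - Q' * R1 n l + Q * R1 n l - R3 (n - 1) l"
    using R1_step[of n l] R3_step[of n l] by (simp_all add: algebra_simps)
  with 3 show ?case by (simp add: gI_add gI_diff gI_left)
next
  case (4 n)
  have "R1 (n - 1) l = Q * (x2 * R1 n l) + Q' * R3 n l - Q * R3 n l - R1 (n + 1) l"
    "R3 (n - 1) l = Q' * (x2 * R3 n l) - Q' * R1 n l + Q * R1 n l - R3 (n + 1) l"
    using R1_step[of n l] R3_step[of n l] by (simp_all add: algebra_simps)
  with 4 show ?case by (simp add: gI_add gI_diff gI_left)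
qed

end


section \<open>Linear extension\<close>

lemma poly_mapping_add_induct [case_names zero single add]:
  assumes "P 0" "\<And>k v. P (Poly_Mapping.single k v)" "\<And>f g. P f \<Longrightarrow> P g \<Longrightarrow> P (f + g)"
  shows "P (f :: 'a \<Rightarrow>\<^sub>0 'b::comm_monoid_add)"
proof (induction f rule: update_induct)
  case const
  show ?case by fact
next
  case (update f a b)
  have "Poly_Mapping.update a b f = f + Poly_Mapping.single a b"
    using update(1)
    by (intro poly_mapping_eqI) (auto simp: lookup_update lookup_add lookup_single in_keys_iff when_def)
  with update assms show ?case by simp
qed

lemma additive_eqI:
  fixes F G :: "('a \<Rightarrow>\<^sub>0 'b::comm_monoid_add) \<Rightarrow> 'c::ab_group_add"
  assumes F: "\<And>f g. F (f + g) = F f + F g" and G: "\<And>f g. G (f + g) = G f + G g"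
    and single: "\<And>k v. F (Poly_Mapping.single k v) = G (Poly_Mapping.single k v)"
  shows "F f = G f"
proof (induction f rule: poly_mapping_add_induct)
  case zero
  show ?case using F[of 0 0] G[of 0 0] by simp
qed (simp_all add: F G single)

text \<open>\<open>c\<close> embeds the coefficients into the target:
  \<open>Poly_Mapping.single 0\<close> when the target is the torus, \<open>scal\<close> when it is
  \<open>T\<close>.\<close>

definition lin_ext :: "('b::comm_monoid_add \<Rightarrow> 'r::ring_1) \<Rightarrow> ('a \<Rightarrow> 'r) \<Rightarrow> ('a \<Rightarrow>\<^sub>0 'b) \<Rightarrow> 'r" where
  "lin_ext c \<phi> f = (\<Sum>w\<in>Poly_Mapping.keys f. c (Poly_Mapping.lookup f w) * \<phi> w)"

lemma lin_ext_superset: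
  assumes "finite A" "Poly_Mapping.keys f \<subseteq> A" "c 0 = 0"
  shows "lin_ext c \<phi> f = (\<Sum>w\<in>A. c (Poly_Mapping.lookup f w) * \<phi> w)"
  unfolding lin_ext_def using assms by (intro sum.mono_neutral_left) (auto simp: in_keys_iff)

lemma lin_ext_single: "c 0 = 0 \<Longrightarrow> lin_ext c \<phi> (Poly_Mapping.single w a) = c a * \<phi> w"
  by (subst lin_ext_superset[of "{w}"]) auto

lemma lin_ext_add:
  assumes "\<And>a b. c (a + b) = c a + c b"
  shows "lin_ext c \<phi> (f + g) = lin_ext c \<phi> f + lin_ext c \<phi> g"
proof -
  have c0: "c 0 = 0" using assms[of 0 0] by simp
  let ?A = "Poly_Mapping.keys f \<union> Poly_Mapping.keys g"
  have "lin_ext c \<phi> h = (\<Sum>w\<in>?A. c (Poly_Mapping.lookup h w) * \<phi> w)"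
    if "Poly_Mapping.keys h \<subseteq> ?A" for h
    using that c0 by (intro lin_ext_superset) auto
  then show ?thesis
    using Poly_Mapping.keys_add[of f g] by (simp add: lookup_add assms distrib_right sum.distrib)
qed

text \<open>The universal property of a monoid algebra. Additivity in each factor reduces it to
  monomials, where centrality moves the second coefficient past \<open>\<phi> v\<close>.\<close>

lemma lin_ext_mult:
  fixes c :: "'b::comm_ring_1 \<Rightarrow> 'r::ring_1" and \<phi> :: "'a::monoid_add \<Rightarrow> 'r"
  assumes c_add: "\<And>a b. c (a + b) = c a + c b" and c_mult: "\<And>a b. c (a * b) = c a * c b"
    and c_central: "\<And>a r. c a * r = r * c a"
    and \<phi>: "\<And>v w. \<phi> (v + w) = \<phi> v * \<phi> w"
  shows "lin_ext c \<phi> (f * g) = lin_ext c \<phi> f * lin_ext c \<phi> g"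
proof -
  note add = lin_ext_add[of c, OF c_add]
  have c0: "c 0 = 0" using c_add[of 0 0] by simp
  have single: "lin_ext c \<phi> (Poly_Mapping.single v a * Poly_Mapping.single w b) =
      lin_ext c \<phi> (Poly_Mapping.single v a) * lin_ext c \<phi> (Poly_Mapping.single w b)" for v w a b
    using c_central[of b "\<phi> v"]
    by (simp add: mult_single lin_ext_single c0 c_mult \<phi>) (metis mult.assoc)
  have left: "lin_ext c \<phi> (Poly_Mapping.single v a * g) = lin_ext c \<phi> (Poly_Mapping.single v a) * lin_ext c \<phi> g"
    for v a
    by (rule additive_eqI[where f = g and F = "\<lambda>g. lin_ext c \<phi> (Poly_Mapping.single v a * g)"
        and G = "\<lambda>g. lin_ext c \<phi> (Poly_Mapping.single v a) * lin_ext c \<phi> g"])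
      (simp_all add: add distrib_left single)
  show ?thesis
    by (rule additive_eqI[where f = f and F = "\<lambda>f. lin_ext c \<phi> (f * g)"
        and G = "\<lambda>f. lin_ext c \<phi> f * lin_ext c \<phi> g"])
      (simp_all add: add distrib_right left)
qed

lemma additive_diff:
  fixes F :: "'a::group_add \<Rightarrow> 'b::group_add"
  assumes "\<And>f g. F (f + g) = F f + F g"
  shows "F (f - g) = F f - F g"
  using assms[of "f - g" g] by (simp add: eq_diff_eq)

lemma single_zero_central:
  fixes f :: "'m::monoid_add \<Rightarrow>\<^sub>0 'k::comm_ring_1"
  shows "Poly_Mapping.single 0 c * f = f * Poly_Mapping.single 0 c"
  by (rule additive_eqI[where f = f and F = "\<lambda>f. Poly_Mapping.single 0 c * f"
      and G = "\<lambda>f. f * Poly_Mapping.single 0 c"])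
    (simp_all add: distrib_left distrib_right mult_single mult.commute)

text \<open>Serves to carry \<open>E\<close> from \<open>T\<close> to the torus. Both sides solve
  the same recurrence; the downward direction needs an inverse of \<open>F v\<close>, which is
  \<open>F v'\<close>.\<close>

lemma recur_hom:
  fixes F :: "'a::ring_1 \<Rightarrow> 'b::ring_1"
  assumes mult: "\<And>a b. F (a * b) = F a * F b" and add: "\<And>a b. F (a + b) = F a + F b" and "F 1 = 1"
    and v: "v * v' = 1" "v' * v = 1"
  shows "F (recur u v a b n) = recur (F u) (F v) (F a) (F b) n"
proof -
  note diff = additive_diff[of F, OF add]
  have Fv: "F v * F v' = 1" "F v' * F v = 1"
    using v \<open>F 1 = 1\<close> by (simp_all flip: mult)
  note r = recur_props[OF v] and r' = recur_props[OF Fv]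
  have down: "F (recur u v a b (n - 1)) = F v' * (F u * F (recur u v a b n) - F (recur u v a b (n + 1)))" for n
    using v by (simp add: r mult[symmetric] diff[symmetric] flip: mult.assoc)
  have down': "recur (F u) (F v) (F a) (F b) (n - 1) =
    F v' * (F u * recur (F u) (F v) (F a) (F b) n - recur (F u) (F v) (F a) (F b) (n + 1))" for n
    using Fv by (simp add: r' flip: mult.assoc)
  show ?thesis
  proof (induction n rule: int_two_step_induct[of _ 0])
    case (3 n)
    then show ?case by (simp only: r r' mult diff)
  next
    case (4 n)
    then show ?case by (simp only: down down')
  qed (simp_all add: r r')
qed


section \<open>The quantum torus as a twisted group algebra\<close>

text \<open>\<open>Mon a k i\<close> stands for \<open>y\<^sup>a Q\<^sup>k x\<^sup>i\<close>.\<close>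

datatype torus_monomial = Mon int int int

instantiation torus_monomial :: monoid_add
begin

definition zero_torus_monomial where "0 = Mon 0 0 0"

text \<open>The term \<open>i * b\<close> comes from x^i y^b = Q^(ib) y^b x^i. This is the integral
  Heisenberg group, so the skew product becomes the ordinary product of a monoid algebra.\<close>

fun plus_torus_monomial where
  "Mon a k i + Mon b l j = Mon (a + b) (k + l + i * b) (i + j)"

instance
proof
  fix u v w :: torus_monomial
  show "u + v + w = u + (v + w)"
    by (cases u; cases v; cases w) (simp add: algebra_simps)
  show "0 + u = u" "u + 0 = u"
    by (cases u; simp add: zero_torus_monomial_def)+
qed

end

type_synonym 'k torus = "torus_monomial \<Rightarrow>\<^sub>0 'k"

definition mon :: "int \<Rightarrow> int \<Rightarrow> int \<Rightarrow> 'k::field torus" where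
  "mon a k i = Poly_Mapping.single (Mon a k i) 1"

lemma mon_mult: "mon a k i * mon b l j = mon (a + b) (k + l + i * b) (i + j)"
  by (simp add: mon_def mult_single)

lemma mon_0: "mon 0 0 0 = 1"
  by (simp add: mon_def flip: zero_torus_monomial_def)

interpretation torus: T_relations "mon 0 1 0 :: 'k::field torus" "mon 0 (- 1) 0"
  "mon 0 0 1 + mon 0 0 (- 1)" "mon 1 0 0 + mon (- 1) 0 0" "mon (- 1) (- 1) 1 + mon 1 (- 1) (- 1)"
  by unfold_locales
    (simp_all add: mon_mult mon_0 distrib_left distrib_right left_diff_distrib right_diff_distrib power2_eq_square)

lemma torus_g: "torus.g = 0"
proof -
  \<comment> \<open>The constant 2 is written in monomials so that it cancels against the other
    terms.\<close>
  have two: "(2 :: 'a torus) = mon 0 0 0 + mon 0 0 0" by (simp add: mon_0)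
  show ?thesis
    unfolding torus.g_def
    by (simp add: two mon_mult distrib_left distrib_right left_diff_distrib right_diff_distrib power2_eq_square)
qed

text \<open>Multiplication by x + x^-1 and y + y^-1 gives the right-hand sides the same recurrences
  as \<open>E0\<close>, \<open>E1\<close> and \<open>E\<close>, so agreement at two neighbouring
  indices suffices each time.\<close>

lemma torus_E: "torus.E k l = mon k 0 l + mon (- k) 0 (- l)"
proof -
  have E0: "torus.E0 l = mon 0 0 l + mon 0 0 (- l)" for l
  proof (induction l rule: int_two_step_induct[of _ 0])
    case 1
    show ?case by (simp add: torus.E0_rec mon_0)
  next
    case 2
    show ?case by (simp add: torus.E0_rec)
  next
    case (3 n)
    then show ?case unfolding torus.E0_rec(3) by (simp add: mon_mult algebra_simps)
  next
    case (4 n)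
    then show ?case unfolding torus.E0_down by (simp add: mon_mult algebra_simps)
  qed
  have E1: "torus.E1 l = mon 1 0 l + mon (- 1) 0 (- l)" for l
  proof (induction l rule: int_two_step_induct[of _ "- 1"])
    case 1
    show ?case by (simp add: torus.E1_rec mon_mult distrib_left)
  next
    case 2
    show ?case by (simp add: torus.E1_rec)
  next
    case (3 n)
    then show ?case unfolding torus.E1_rec(3) by (simp add: mon_mult algebra_simps)
  next
    case (4 n)
    then show ?case unfolding torus.E1_down by (simp add: mon_mult algebra_simps)
  qed
  show ?thesis
  proof (induction k rule: int_two_step_induct[of _ 0])
    case 1
    show ?case by (simp add: torus.E_rec E0)
  next
    case 2
    show ?case by (simp add: torus.E_rec E1)
  next
    case (3 n)
    then show ?case unfolding torus.E_rec(3) by (simp add: mon_mult algebra_simps)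
  next
    case (4 n)
    then show ?case unfolding torus.E_rec_down by (simp add: mon_mult algebra_simps)
  qed
qed


section \<open>The algebra \<open>T\<close> and its kernel over the torus\<close>

lemma monoid_alg_simps [simp]:
  "carrier monoid_alg = UNIV" "x \<otimes>\<^bsub>monoid_alg\<^esub> y = x * y" "\<one>\<^bsub>monoid_alg\<^esub> = 1"
  "\<zero>\<^bsub>monoid_alg\<^esub> = 0" "x \<oplus>\<^bsub>monoid_alg\<^esub> y = x + y"
  "c \<odot>\<^bsub>monoid_alg\<^esub> x = Poly_Mapping.single 0 c * x"
  by (simp_all add: monoid_alg_def mult_map_scale_conv_mult)

lemma ring_monoid_alg: "ring monoid_alg"
proof (rule ringI)
  show "abelian_group monoid_alg"
    by (rule abelian_groupI) (auto simp: add_ac intro: exI[of _ "- _"] add.left_inverse)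
  show "Group.monoid monoid_alg"
    by (rule Group.monoid.intro) (simp_all add: mult.assoc)
qed (simp_all add: distrib_left distrib_right)

abbreviation T_ideal :: "(T_gen, 'k::field) free_alg set" where
  "T_ideal \<equiv> genideal monoid_alg T_rels"

lemma T_ideal_ideal: "ideal T_ideal monoid_alg"
  by (rule ring.genideal_ideal[OF ring_monoid_alg]) simp

lemma T_ideal_rels: "f \<in> T_rels \<Longrightarrow> f \<in> T_ideal"
  using ring.genideal_self[OF ring_monoid_alg, of T_rels] by auto

lemma T_ideal_0: "0 \<in> T_ideal"
  using additive_subgroup.zero_closed[OF ideal.axioms(1)[OF T_ideal_ideal]] by simp

lemma T_ideal_add: "f \<in> T_ideal \<Longrightarrow> h \<in> T_ideal \<Longrightarrow> f + h \<in> T_ideal"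
  using additive_subgroup.a_closed[OF ideal.axioms(1)[OF T_ideal_ideal]] by fastforce

lemma T_ideal_mult_left: "f \<in> T_ideal \<Longrightarrow> h * f \<in> T_ideal"
  using ideal.I_l_closed[OF T_ideal_ideal, of f h] by simp

lemma T_ideal_mult_right: "f \<in> T_ideal \<Longrightarrow> f * h \<in> T_ideal"
  using ideal.I_r_closed[OF T_ideal_ideal, of f h] by simp

lemma T_ideal_uminus: "f \<in> T_ideal \<Longrightarrow> - f \<in> T_ideal"
  using T_ideal_mult_left[of f "- 1"] by simp

lemma T_ideal_diff: "f \<in> T_ideal \<Longrightarrow> h \<in> T_ideal \<Longrightarrow> f - h \<in> T_ideal"
  using T_ideal_add[of f "- h"] T_ideal_uminus[of h] by simp

fun torus_gen :: "T_gen \<Rightarrow> 'k::field torus" where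
  "torus_gen GQ = mon 0 1 0"
| "torus_gen GQinv = mon 0 (- 1) 0"
| "torus_gen GX1 = mon 0 0 1 + mon 0 0 (- 1)"
| "torus_gen GX2 = mon 1 0 0 + mon (- 1) 0 0"
| "torus_gen GX3 = mon (- 1) (- 1) 1 + mon 1 (- 1) (- 1)"

definition \<phi> :: "(T_gen, 'k::field) free_alg \<Rightarrow> 'k torus" where
  "\<phi> = lin_ext (Poly_Mapping.single 0) (\<lambda>w. prod_list (map torus_gen w))"

lemma \<phi>_add: "\<phi> (f + h) = \<phi> f + \<phi> h"
  by (simp add: \<phi>_def lin_ext_add single_add)

lemma \<phi>_mult: "\<phi> (f * h) = \<phi> f * \<phi> h"
  unfolding \<phi>_def
  by (rule lin_ext_mult) (simp_all add: single_add mult_single single_zero_central plus_list_def)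

lemma \<phi>_scalar: "\<phi> (Poly_Mapping.single 0 c) = Poly_Mapping.single 0 c"
  by (simp add: \<phi>_def lin_ext_single zero_list_def)

lemma \<phi>_1 [simp]: "\<phi> 1 = 1"
  using \<phi>_scalar[of 1] by simp

lemma \<phi>_var: "\<phi> (var v) = torus_gen v"
  by (simp add: \<phi>_def lin_ext_single var_def)

lemma \<phi>_2: "\<phi> 2 = 2"
  using \<phi>_add[of 1 1] by simp

lemmas \<phi>_diff = additive_diff[of \<phi>, OF \<phi>_add]

lemma \<phi>_0 [simp]: "\<phi> 0 = 0"
  using \<phi>_diff[of 0 0] by simp

lemmas \<phi>_hom = \<phi>_add \<phi>_mult \<phi>_diff \<phi>_var power2_eq_square

text \<open>The kernel of \<open>\<phi>\<close> is an ideal containing the relators, hence contains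
  the ideal they generate.\<close>

lemma \<phi>_T_ideal:
  assumes "f \<in> T_ideal"
  shows "\<phi> f = 0"
proof -
  have "ideal {f :: (T_gen, 'a) free_alg. \<phi> f = 0} monoid_alg"
  proof (rule idealI[OF ring_monoid_alg])
    show "subgroup {f :: (T_gen, 'a) free_alg. \<phi> f = 0} (add_monoid monoid_alg)"
    proof (rule group.subgroupI[OF abelian_group.a_group])
      show "abelian_group (monoid_alg :: ('a, (T_gen, 'a) free_alg) module)"
        using ring_monoid_alg by (rule ring.is_abelian_group)
    next
      fix a :: "(T_gen, 'a) free_alg"
      assume "a \<in> {f. \<phi> f = 0}"
      moreover have "inv\<^bsub>add_monoid monoid_alg\<^esub> a = - a"
        using abelian_group.minus_equality[OF ring.is_abelian_group[OF ring_monoid_alg], of "- a" a]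
        by (simp add: a_inv_def)
      ultimately show "inv\<^bsub>add_monoid monoid_alg\<^esub> a \<in> {f. \<phi> f = 0}"
        using \<phi>_diff[of 0 a] by simp
    qed (auto simp: \<phi>_add intro: exI[of _ 0])
  qed (simp_all add: \<phi>_mult)
  moreover have "T_rels \<subseteq> {f :: (T_gen, 'a) free_alg. \<phi> f = 0}"
    using torus.x1_Q torus.x2_Q torus.x3_Q torus.x1_Q' torus.x2_Q' torus.x3_Q' torus.Q_Q' torus.Q'_Q
      torus.x1_x2 torus.x2_x3 torus.x1_x3
    by (simp add: T_rels_def Let_def \<phi>_hom)
  ultimately have "T_ideal \<subseteq> {f :: (T_gen, 'a) free_alg. \<phi> f = 0}"
    by (rule ring.genideal_minimal[OF ring_monoid_alg])
  with assms show ?thesis by auto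
qed

text \<open>Without this, lifting would unfold \<open>poly_mapping\<close> to raw functions as well.\<close>

lifting_forget poly_mapping.lifting

\<comment> \<open>\<open>T\<close> is built a second time, as a type of class \<open>ring_1\<close>,
  so that \<open>T_relations\<close> can be interpreted in it. \<open>T_class_eq_iff\<close> links
  it to the cosets that make up \<open>T_alg\<close>.\<close>
quotient_type (overloaded) 'k T = "(T_gen, 'k::field) free_alg" / "\<lambda>f h. f - h \<in> T_ideal"
proof (rule equivpI)
  show "reflp (\<lambda>f h. f - h \<in> T_ideal)"
    by (rule reflpI) (simp add: T_ideal_0)
  show "symp (\<lambda>f h. f - h \<in> T_ideal)"
    by (rule sympI) (use T_ideal_uminus in fastforce)
  show "transp (\<lambda>f h. f - h \<in> T_ideal)"
    by (rule transpI) (use T_ideal_add in fastforce)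
qed

instantiation T :: (field) ring_1
begin

lift_definition zero_T :: "'a T" is 0 .
lift_definition one_T :: "'a T" is 1 .

lift_definition plus_T :: "'a T \<Rightarrow> 'a T \<Rightarrow> 'a T" is "(+)"
  using T_ideal_add by (fastforce simp: algebra_simps)

lift_definition minus_T :: "'a T \<Rightarrow> 'a T \<Rightarrow> 'a T" is "(-)"
  using T_ideal_diff by (fastforce simp: algebra_simps)

lift_definition uminus_T :: "'a T \<Rightarrow> 'a T" is uminus
  using T_ideal_uminus by (fastforce simp: algebra_simps)

lift_definition times_T :: "'a T \<Rightarrow> 'a T \<Rightarrow> 'a T" is "(*)"
proof -
  fix f f' h h' :: "(T_gen, 'a) free_alg"
  assume "f - f' \<in> T_ideal" "h - h' \<in> T_ideal"
  then have "(f - f') * h + f' * (h - h') \<in> T_ideal"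
    by (intro T_ideal_add T_ideal_mult_left T_ideal_mult_right)
  then show "f * h - f' * h' \<in> T_ideal" by (simp add: algebra_simps)
qed

instance
proof
  show "(0 :: 'a T) \<noteq> 1"
  proof transfer
    show "0 - 1 \<notin> (T_ideal :: (T_gen, 'a) free_alg set)"
    proof
      assume "0 - 1 \<in> (T_ideal :: (T_gen, 'a) free_alg set)"
      \<comment> \<open>\<open>T\<close> is not the zero ring because \<open>\<phi>\<close> kills
        the ideal but sends 1 to 1.\<close>
      from \<phi>_T_ideal[OF this] show False by (simp only: \<phi>_diff \<phi>_0 \<phi>_1) simp
    qed
  qed
qed (transfer, simp add: algebra_simps T_ideal_0)+

end

lift_definition \<pi> :: "(T_gen, 'k::field) free_alg \<Rightarrow> 'k T" is "\<lambda>f. f" .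

lemma \<pi>_0 [simp]: "\<pi> 0 = 0"
  by (transfer; simp add: T_ideal_0)

lemma \<pi>_1 [simp]: "\<pi> 1 = 1"
  by (transfer; simp add: T_ideal_0)

lemma \<pi>_add: "\<pi> (f + h) = \<pi> f + \<pi> h"
  by (transfer; simp add: T_ideal_0)

lemma \<pi>_diff: "\<pi> (f - h) = \<pi> f - \<pi> h"
  by (transfer; simp add: T_ideal_0)

lemma \<pi>_mult: "\<pi> (f * h) = \<pi> f * \<pi> h"
  by (transfer; simp add: T_ideal_0)

lemma \<pi>_2: "\<pi> 2 = 2"
  using \<pi>_add[of 1 1] by simp

lemma \<pi>_eq_iff: "\<pi> f = \<pi> h \<longleftrightarrow> f - h \<in> T_ideal"
  by transfer simp

lemma \<pi>_surj: "\<exists>f. t = \<pi> f"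
  by transfer (metis diff_self T_ideal_0)

lemma \<pi>_rels: "f \<in> T_rels \<Longrightarrow> \<pi> f = 0"
  using \<pi>_eq_iff[of f 0] T_ideal_rels[of f] by simp

interpretation T: T_relations "\<pi> (var GQ) :: 'k::field T" "\<pi> (var GQinv)" "\<pi> (var GX1)"
  "\<pi> (var GX2)" "\<pi> (var GX3)"
proof -
  have rel: "a = b" if "\<pi> f = a - b" "f \<in> T_rels" for f and a b :: "'k T"
    using that \<pi>_rels[of f] by simp
  note hom = \<pi>_add \<pi>_diff \<pi>_mult power2_eq_square
  let ?Q = "var GQ :: (T_gen, 'k) free_alg" and ?Q' = "var GQinv :: (T_gen, 'k) free_alg"
  let ?x1 = "var GX1 :: (T_gen, 'k) free_alg" and ?x2 = "var GX2 :: (T_gen, 'k) free_alg"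
    and ?x3 = "var GX3 :: (T_gen, 'k) free_alg"
  show "T_relations (\<pi> ?Q) (\<pi> ?Q') (\<pi> ?x1) (\<pi> ?x2) (\<pi> ?x3)"
    by (unfold_locales;
      (rule rel[of "?x1 * ?Q - ?Q * ?x1"] rel[of "?x2 * ?Q - ?Q * ?x2"] rel[of "?x3 * ?Q - ?Q * ?x3"]
        rel[of "?x1 * ?Q' - ?Q' * ?x1"] rel[of "?x2 * ?Q' - ?Q' * ?x2"] rel[of "?x3 * ?Q' - ?Q' * ?x3"]
        rel[of "?Q * ?Q' - 1"] rel[of "?Q' * ?Q - 1"]
        rel[of "?x1 * ?x2 - (?Q * ?x2 * ?x1 + (1 - ?Q\<^sup>2) * ?x3)"]
        rel[of "?x2 * ?x3 - (?Q * ?x3 * ?x2 + (?Q' - ?Q) * ?x1)"]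
        rel[of "?x1 * ?x3 - (?Q' * ?x3 * ?x1 + (1 - ?Q'\<^sup>2) * ?x2)"];
       simp add: hom T_rels_def Let_def; fail))
qed

lift_definition \<phi>\<^sub>T :: "'k::field T \<Rightarrow> 'k torus" is \<phi>
  by (metis \<phi>_T_ideal \<phi>_diff eq_iff_diff_eq_0)

lemma \<phi>\<^sub>T_\<pi>: "\<phi>\<^sub>T (\<pi> f) = \<phi> f"
  by transfer simp

lemma \<phi>\<^sub>T_1: "\<phi>\<^sub>T 1 = 1" and \<phi>\<^sub>T_add: "\<phi>\<^sub>T (s + t) = \<phi>\<^sub>T s + \<phi>\<^sub>T t"
  and \<phi>\<^sub>T_mult: "\<phi>\<^sub>T (s * t) = \<phi>\<^sub>T s * \<phi>\<^sub>T t"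
  by (transfer, simp add: \<phi>_add \<phi>_mult)+

text \<open>Words grow by one letter on the left, which suits statements about left
  multiplication.\<close>

lemma free_alg_induct [case_names scalar var add]:
  fixes f :: "('x, 'k::field) free_alg"
  assumes scalar: "\<And>c. P (Poly_Mapping.single 0 c)" and var: "\<And>v f. P f \<Longrightarrow> P (var v * f)"
    and add: "\<And>f h. P f \<Longrightarrow> P h \<Longrightarrow> P (f + h)"
  shows "P f"
proof (induction f rule: poly_mapping_add_induct)
  case zero
  show ?case using scalar[of 0] by simp
next
  case (single w c)
  show ?case
  proof (induction w)
    case Nil
    show ?case using scalar[of c] by (simp add: zero_list_def)
  next
    case (Cons v w)
    then show ?case using var[of "Poly_Mapping.single w c" v]
      by (simp add: var_def mult_single plus_list_def)
  qed
qed (rule add)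

section \<open>Scalars and the centrality of g in T\<close>

definition scal :: "'k::field \<Rightarrow> 'k T" where
  "scal c = \<pi> (Poly_Mapping.single 0 c)"

lemma scal_0 [simp]: "scal 0 = 0" and scal_1 [simp]: "scal 1 = 1"
  and scal_add: "scal (a + b) = scal a + scal b" and scal_mult: "scal (a * b) = scal a * scal b"
  by (simp_all add: scal_def single_add \<pi>_add mult_single flip: \<pi>_mult)

lemma scal_central: "scal c * t = t * scal c"
  using \<pi>_surj[of t] single_zero_central by (metis \<pi>_mult scal_def)

lemma \<phi>\<^sub>T_scal: "\<phi>\<^sub>T (scal c) = Poly_Mapping.single 0 c"
  by (simp add: scal_def \<phi>\<^sub>T_\<pi> \<phi>_scalar)

text \<open>Commutation with generators and scalars extends to all of \<open>T\<close> by induction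
  on a representative in the free algebra.\<close>

lemma T_g_central: "T.g * t = t * T.g"
proof -
  obtain f where t: "t = \<pi> f" using \<pi>_surj by blast
  show ?thesis
    unfolding t
  proof (induction f rule: free_alg_induct)
    case (scalar c)
    show ?case using scal_central[of c T.g] by (simp add: scal_def)
  next
    case (var v f)
    have *: "T.g * \<pi> (var v) = \<pi> (var v) * T.g"
      by (cases v) (simp_all add: T.g_x1 T.g_x2 T.g_x3 T.g_Q T.g_Q')
    have "T.g * \<pi> (var v * f) = \<pi> (var v) * (T.g * \<pi> f)"
      by (simp add: \<pi>_mult * flip: mult.assoc)
    also have "\<dots> = \<pi> (var v * f) * T.g"
      by (simp add: \<pi>_mult var mult.assoc)
    finally show ?case .
  next
    case (add f h)
    then show ?case by (simp add: \<pi>_add distrib_left distrib_right)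
  qed
qed

section \<open>The linear map \<psi> from the torus to T\<close>

fun \<psi>_mon :: "torus_monomial \<Rightarrow> 'k::field T" where
  "\<psi>_mon (Mon a k i) = scal (inverse 2) * (T.qpow k * T.E a i)"

definition \<psi> :: "'k::field torus \<Rightarrow> 'k T" where
  "\<psi> = lin_ext scal \<psi>_mon"

lemma \<psi>_add: "\<psi> (s + t) = \<psi> s + \<psi> t"
  by (simp add: \<psi>_def lin_ext_add scal_add)

lemma \<psi>_single: "\<psi> (Poly_Mapping.single u c) = scal c * \<psi>_mon u"
  by (simp add: \<psi>_def lin_ext_single)

lemma \<psi>_scalar: "\<psi> (Poly_Mapping.single 0 c * s) = scal c * \<psi> s"
  by (rule additive_eqI[where f = s and F = "\<lambda>s. \<psi> (Poly_Mapping.single 0 c * s)"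
      and G = "\<lambda>s. scal c * \<psi> s"])
    (simp_all add: \<psi>_add distrib_left mult_single \<psi>_single scal_mult mult.assoc)

text \<open>The factor one half cancels the starting value \<open>E 0 0 = 2\<close>; this requires
  characteristic different from 2.\<close>

lemma \<psi>_1:
  assumes "(2 :: 'k::field) \<noteq> 0"
  shows "\<psi> (1 :: 'k torus) = 1"
proof -
  have "\<psi> (1 :: 'k torus) = \<psi>_mon 0"
    using \<psi>_single[of 0 "1 :: 'k"] by simp
  then have "\<psi> (1 :: 'k torus) = scal (inverse 2) * (1 + 1)"
    by (simp add: zero_torus_monomial_def T.E_rec T.E0_rec)
  also have "\<dots> = scal (inverse 2 + inverse 2)" by (simp only: distrib_left mult_1_right scal_add)
  also have "inverse 2 + inverse 2 = (1 :: 'k)"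
    using assms by (metis mult_2 right_inverse)
  finally show ?thesis by simp
qed

lemma \<psi>_mon: "\<psi> (mon a k i) = scal (inverse 2) * (T.qpow k * T.E a i)"
  by (simp add: mon_def \<psi>_single)

lemma scal_left_commute: "s * (scal c * t) = scal c * (s * t)"
  by (metis mult.assoc scal_central)

lemma T_gI_left: "t \<in> T.gI \<Longrightarrow> s * t \<in> T.gI"
  by (rule T.gI_commuting) (simp_all add: T_g_central)

text \<open>For \<open>x1\<close> and \<open>x3\<close> the difference is a left multiple of the
  defect \<open>R1\<close> or \<open>R3\<close>. For \<open>x2\<close> it vanishes by the recurrence
  of \<open>E\<close> in k, and for \<open>Q\<close> and its inverse by that of
  \<open>qpow\<close>.\<close>

lemma \<psi>_torus_gen_mon:
  "\<psi> (torus_gen v * mon a k i) - \<pi> (var v) * \<psi> (mon a k i) \<in> T.gI"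
  (is "?d \<in> _")
proof (cases v)
  case GX1
  have "?d =
    (- scal (inverse 2) * T.qpow k) * T.R1 a i"
    by (simp add: GX1 distrib_right mon_mult \<psi>_add \<psi>_mon T.R1_def T.qpow_add[of k a, unfolded add.commute[of k a]] T.qpow_left
      scal_left_commute T.qpow_diff algebra_simps)
  then show ?thesis using T.R1_R3_gI T_gI_left by metis
next
  case GX3
  \<comment> \<open>The additional factor is the inverse of \<open>Q\<close>, since
    \<open>R3\<close> is the defect for \<open>Q * x3\<close>.\<close>
  have "?d =
    (- scal (inverse 2) * T.qpow k * \<pi> (var GQinv)) * T.R3 a i"
    by (simp add: GX3 distrib_right mon_mult \<psi>_add \<psi>_mon T.R3_def T.qpow_add[of k a, unfolded add.commute[of k a]] T.qpow_left
      scal_left_commute T.qpow_diff algebra_simps T.left_rules)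
  then show ?thesis using T.R1_R3_gI T_gI_left by metis
next
  case GX2
  have "?d = 0"
    by (simp add: GX2 distrib_right mon_mult \<psi>_add \<psi>_mon T.qpow_left scal_left_commute)
      (simp add: T.E_rec(3)[of a, unfolded add.commute[of a 1]] algebra_simps)
  then show ?thesis by simp
next
  case GQ
  have "?d = 0"
    by (simp add: GQ mon_mult \<psi>_mon scal_left_commute add.commute[of 1] T.qpow_plus1 mult.assoc)
  then show ?thesis by simp
next
  case GQinv
  have "?d = 0"
    by (simp add: GQinv mon_mult \<psi>_mon scal_left_commute T.qpow_minus1 mult.assoc)
  then show ?thesis by simp
qed

lemma \<psi>_torus_gen: "\<psi> (torus_gen v * s) - \<pi> (var v) * \<psi> s \<in> T.gI"
proof (induction s rule: poly_mapping_add_induct)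
  case zero
  have "\<psi> 0 = (0 :: 'a T)" using \<psi>_scalar[of 0 0] by simp
  then show ?case by simp
next
  case (add s t)
  have "\<psi> (torus_gen v * (s + t)) - \<pi> (var v) * \<psi> (s + t) =
    (\<psi> (torus_gen v * s) - \<pi> (var v) * \<psi> s) + (\<psi> (torus_gen v * t) - \<pi> (var v) * \<psi> t)"
    by (simp add: \<psi>_add algebra_simps)
  with add show ?case by (simp add: T.gI_add)
next
  case (single u c)
  obtain a k i where "u = Mon a k i" by (cases u)
  then have u: "Poly_Mapping.single u c = Poly_Mapping.single 0 c * mon a k i"
    by (simp add: mon_def mult_single)
  have "torus_gen v * (Poly_Mapping.single 0 c * mon a k i) =
      Poly_Mapping.single 0 c * (torus_gen v * mon a k i)"
    by (metis mult.assoc single_zero_central)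
  then have "\<psi> (torus_gen v * Poly_Mapping.single u c) - \<pi> (var v) * \<psi> (Poly_Mapping.single u c) =
      scal c * (\<psi> (torus_gen v * mon a k i) - \<pi> (var v) * \<psi> (mon a k i))"
    unfolding u by (simp add: \<psi>_scalar scal_left_commute right_diff_distrib)
  then show ?case by (simp add: T_gI_left \<psi>_torus_gen_mon)
qed

text \<open>Modulo \<open>g\<close>, \<open>\<psi>\<close> is linear over the free algebra acting on
  the torus through \<open>\<phi>\<close>. Each letter is peeled off by
  \<open>\<psi>_torus_gen\<close>, applied to \<open>\<phi> f * s\<close> in place of
  \<open>s\<close>.\<close>

lemma \<psi>_\<phi>_mult: "\<psi> (\<phi> f * s) - \<pi> f * \<psi> s \<in> T.gI"
proof (induction f rule: free_alg_induct)
  case (scalar c)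
  show ?case by (simp add: \<phi>_scalar \<psi>_scalar scal_def)
next
  case (var v f)
  have "\<psi> (\<phi> (var v * f) * s) - \<pi> (var v * f) * \<psi> s =
      (\<psi> (torus_gen v * (\<phi> f * s)) - \<pi> (var v) * \<psi> (\<phi> f * s)) +
      \<pi> (var v) * (\<psi> (\<phi> f * s) - \<pi> f * \<psi> s)"
    by (simp add: \<phi>_mult \<phi>_var \<pi>_mult algebra_simps)
  with var show ?case by (simp add: T.gI_add T_gI_left \<psi>_torus_gen)
next
  case (add f h)
  have "\<psi> (\<phi> (f + h) * s) - \<pi> (f + h) * \<psi> s =
      (\<psi> (\<phi> f * s) - \<pi> f * \<psi> s) + (\<psi> (\<phi> h * s) - \<pi> h * \<psi> s)"
    by (simp add: \<phi>_add \<psi>_add \<pi>_add algebra_simps)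
  with add show ?case by (simp add: T.gI_add)
qed

section \<open>The kernel of \<phi>\<close>

lemma T_g_eq:
  "T.g = \<pi> (var GX3 * var GX2 * var GX1 - var GQ * (var GX3)\<^sup>2 - (var GQinv)\<^sup>2 * (var GX2)\<^sup>2
      - (var GX1)\<^sup>2 + 2 * (1 + (var GQinv)\<^sup>2))"
  by (simp add: T.g_def \<pi>_2 \<pi>_add \<pi>_diff \<pi>_mult power2_eq_square)

lemma \<phi>\<^sub>T_g: "\<phi>\<^sub>T T.g = 0"
  unfolding T_g_eq using torus_g
  by (simp add: \<phi>\<^sub>T_\<pi> \<phi>_hom \<phi>_2 torus.g_def)

lemma \<phi>_eq_0_iff:
  fixes f :: "(T_gen, 'k::field) free_alg"
  assumes "(2 :: 'k) \<noteq> 0"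
  shows "\<phi> f = 0 \<longleftrightarrow> \<pi> f \<in> T.gI"
proof
  assume "\<phi> f = 0"
  moreover have "\<psi> 0 = (0 :: 'k T)" using \<psi>_scalar[of 0 0] by simp
  \<comment> \<open>The case s = 1 of \<open>\<psi>_\<phi>_mult\<close> leaves only this term, as
    \<open>\<psi> 1 = 1\<close>.\<close>
  ultimately have "0 - \<pi> f \<in> T.gI"
    using \<psi>_\<phi>_mult[of f 1] \<psi>_1[OF assms] by simp
  then show "\<pi> f \<in> T.gI" using T.gI_diff[of 0 "0 - \<pi> f"] by simp
next
  assume "\<pi> f \<in> T.gI"
  then obtain t where "\<pi> f = T.g * t" by (auto simp: T.gI_def)
  then show "\<phi> f = 0" by (metis \<phi>\<^sub>T_\<pi> \<phi>\<^sub>T_g \<phi>\<^sub>T_mult mult_zero_left)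
qed

text \<open>The effect of \<theta> on monomials. No power of Q appears because a homomorphism keeps
  the order of the factors y, Q, x.\<close>

fun rev_mon :: "torus_monomial \<Rightarrow> torus_monomial" where
  "rev_mon (Mon a k i) = Mon (- a) k (- i)"

lemma \<phi>\<^sub>T_qpow: "\<phi>\<^sub>T (T.qpow k) = mon 0 k 0"
proof (induction k rule: int_induct[of _ 0])
  case base
  show ?case by (simp add: mon_0 \<phi>\<^sub>T_1)
next
  case (step1 k)
  then show ?case unfolding T.qpow_plus1 by (simp add: \<phi>\<^sub>T_mult \<phi>\<^sub>T_\<pi> \<phi>_var mon_mult add.commute)
next
  case (step2 k)
  then show ?case unfolding T.qpow_minus1 by (simp add: \<phi>\<^sub>T_mult \<phi>\<^sub>T_\<pi> \<phi>_var mon_mult)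
qed

text \<open>\<open>E\<close> is the same expression in the generators in both rings, so
  \<open>recur_hom\<close> maps one to the other and \<open>torus_E\<close> evaluates it.\<close>

lemma \<phi>\<^sub>T_E: "\<phi>\<^sub>T (T.E k l :: 'a::field T) = mon k 0 l + mon (- k) 0 (- l)"
proof -
  note hom = recur_hom[of \<phi>\<^sub>T, OF \<phi>\<^sub>T_mult \<phi>\<^sub>T_add \<phi>\<^sub>T_1]
  \<comment> \<open>The recurrence of \<open>E1\<close> has the coefficient \<open>Q' * Q'\<close>,
    whose invertibility \<open>recur_hom\<close> requires.\<close>
  have QQ: "(\<pi> (var GQinv) * \<pi> (var GQinv)) * (\<pi> (var GQ) * \<pi> (var GQ)) = (1 :: 'a T)"
    "(\<pi> (var GQ) * \<pi> (var GQ)) * (\<pi> (var GQinv) * \<pi> (var GQinv)) = (1 :: 'a T)"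
    by (simp_all add: T.normal_order)
  have 2: "\<phi>\<^sub>T 2 = (2 :: 'a torus)"
    using \<phi>\<^sub>T_add[of "1 :: 'a T" 1] by (simp add: \<phi>\<^sub>T_1)
  have "\<phi>\<^sub>T (T.E k l :: 'a T) = torus.E k l"
    unfolding T.E_def T.E0_def T.E1_def torus.E_def torus.E0_def torus.E1_def
    by (simp add: hom[of 1 1] hom[OF QQ] 2 \<phi>\<^sub>T_mult \<phi>\<^sub>T_1 \<phi>\<^sub>T_\<pi> \<phi>_var)
  then show ?thesis by (simp add: torus_E)
qed

text \<open>\<open>\<rho>\<close> stands for the involution, which is transported to this model of
  the torus only later; additivity and its values on monomials suffice here.\<close>

lemma \<phi>\<^sub>T_\<psi>:
  fixes s :: "'k::field torus" and \<rho> :: "'k torus \<Rightarrow> 'k torus"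
  assumes 2: "(2 :: 'k) \<noteq> 0" and \<rho>_add: "\<And>s t. \<rho> (s + t) = \<rho> s + \<rho> t"
    and \<rho>: "\<And>u c. \<rho> (Poly_Mapping.single u c) = Poly_Mapping.single (rev_mon u) c"
  shows "\<phi>\<^sub>T (\<psi> s) = Poly_Mapping.single 0 (inverse 2) * (s + \<rho> s)"
proof (rule additive_eqI[where f = s and F = "\<lambda>s. \<phi>\<^sub>T (\<psi> s)"
    and G = "\<lambda>s. Poly_Mapping.single 0 (inverse 2) * (s + \<rho> s)"])
  fix u and c :: 'k
  obtain a k i where u: "u = Mon a k i" by (cases u)
  show "\<phi>\<^sub>T (\<psi> (Poly_Mapping.single u c)) =
    Poly_Mapping.single 0 (inverse 2) * (Poly_Mapping.single u c + \<rho> (Poly_Mapping.single u c))"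
    by (simp add: u \<rho> \<psi>_single \<phi>\<^sub>T_mult \<phi>\<^sub>T_scal \<phi>\<^sub>T_qpow \<phi>\<^sub>T_E distrib_left mon_def mult_single
      mult.commute)
qed (simp_all add: \<psi>_add \<phi>\<^sub>T_add \<rho>_add algebra_simps)


section \<open>The skew Laurent presentation and the involution\<close>

lemma skew_mult_superset:
  assumes "finite A" "Poly_Mapping.keys f \<subseteq> A" "finite B" "Poly_Mapping.keys h \<subseteq> B"
    and "\<And>i. int_iter \<alpha> i 0 = 0"
  shows "skew_mult \<alpha> f h = (\<Sum>i\<in>A. \<Sum>j\<in>B.
    Poly_Mapping.single (i + j) (Poly_Mapping.lookup f i * int_iter \<alpha> i (Poly_Mapping.lookup h j)))"
proof -
  have "skew_mult \<alpha> f h = (\<Sum>i\<in>Poly_Mapping.keys f. \<Sum>j\<in>B.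
    Poly_Mapping.single (i + j) (Poly_Mapping.lookup f i * int_iter \<alpha> i (Poly_Mapping.lookup h j)))"
    unfolding skew_mult_def using assms
    by (intro sum.cong sum.mono_neutral_left) (auto simp: in_keys_iff)
  also have "\<dots> = (\<Sum>i\<in>A. \<Sum>j\<in>B.
    Poly_Mapping.single (i + j) (Poly_Mapping.lookup f i * int_iter \<alpha> i (Poly_Mapping.lookup h j)))"
    using assms by (intro sum.mono_neutral_left) (auto simp: in_keys_iff)
  finally show ?thesis .
qed

lemma skew_mult_add_left:
  assumes "\<And>i. int_iter \<alpha> i 0 = 0"
  shows "skew_mult \<alpha> (f + f') h = skew_mult \<alpha> f h + skew_mult \<alpha> f' h"
proof -
  let ?A = "Poly_Mapping.keys f \<union> Poly_Mapping.keys f'" and ?B = "Poly_Mapping.keys h"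
  have "skew_mult \<alpha> p h = (\<Sum>i\<in>?A. \<Sum>j\<in>?B.
    Poly_Mapping.single (i + j) (Poly_Mapping.lookup p i * int_iter \<alpha> i (Poly_Mapping.lookup h j)))"
    if "Poly_Mapping.keys p \<subseteq> ?A" for p
    using that assms by (intro skew_mult_superset) auto
  then show ?thesis
    using Poly_Mapping.keys_add[of f f']
    by (simp add: lookup_add distrib_right single_add sum.distrib)
qed

lemma skew_mult_add_right:
  assumes add: "\<And>i p q. int_iter \<alpha> i (p + q) = int_iter \<alpha> i p + int_iter \<alpha> i q"
  shows "skew_mult \<alpha> f (h + h') = skew_mult \<alpha> f h + skew_mult \<alpha> f h'"
proof -
  have 0: "int_iter \<alpha> i 0 = 0" for i using add[of i 0 0] by simp
  let ?A = "Poly_Mapping.keys f" and ?B = "Poly_Mapping.keys h \<union> Poly_Mapping.keys h'"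
  have "skew_mult \<alpha> f p = (\<Sum>i\<in>?A. \<Sum>j\<in>?B.
    Poly_Mapping.single (i + j) (Poly_Mapping.lookup f i * int_iter \<alpha> i (Poly_Mapping.lookup p j)))"
    if "Poly_Mapping.keys p \<subseteq> ?B" for p
    using that 0 by (intro skew_mult_superset) auto
  then show ?thesis
    using Poly_Mapping.keys_add[of h h']
    by (simp add: lookup_add add distrib_left single_add sum.distrib)
qed

lemma skew_mult_single:
  assumes "\<And>i. int_iter \<alpha> i 0 = 0"
  shows "skew_mult \<alpha> (Poly_Mapping.single i p) (Poly_Mapping.single j q) =
    Poly_Mapping.single (i + j) (p * int_iter \<alpha> i q)"
  by (subst skew_mult_superset[of "{i}" _ "{j}"]) (use assms in auto)

text \<open>Determines \<alpha> and the involution on integer powers of a generator. In the negative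
  direction, \<open>F (- 1)\<close> and \<open>G (- 1)\<close> are inverses of the same
  element.\<close>

lemma int_hom_unique:
  fixes F G :: "int \<Rightarrow> 'r::monoid_mult"
  assumes F: "\<And>i j. F (i + j) = F i * F j" "F 0 = 1" and G: "\<And>i j. G (i + j) = G i * G j" "G 0 = 1"
    and 1: "F 1 = G 1"
  shows "F n = G n"
proof (induction n rule: int_induct[of _ 0])
  case (step2 n)
  have "F (- 1) = F (- 1) * (G 1 * G (- 1))" using G(1)[of 1 "- 1"] G(2) by simp
  also have "\<dots> = G (- 1)" using F(1)[of "- 1" 1] F(2) 1 by (simp flip: mult.assoc)
  finally show ?case using step2 F(1)[of n "- 1"] G(1)[of n "- 1"] by simp
qed (simp_all add: assms)

section \<open>The automorphism \<alpha> and its iterates on monomials\<close>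

locale torus_automorphism =
  fixes \<alpha> :: "'k::field laurent2 \<Rightarrow> 'k laurent2"
  assumes \<alpha>_iso: "\<alpha> \<in> alg_iso laurent2_alg laurent2_alg"
    and \<alpha>_y: "\<alpha> y_L = Q_L * y_L" and \<alpha>_Q: "\<alpha> Q_L = Q_L"
begin

lemma bij_\<alpha>: "bij \<alpha>"
  and \<alpha>_add: "\<alpha> (p + q) = \<alpha> p + \<alpha> q"
  and \<alpha>_mult: "\<alpha> (p * q) = \<alpha> p * \<alpha> q"
  and \<alpha>_1: "\<alpha> 1 = 1"
  using \<alpha>_iso by (simp_all add: alg_iso_def ring_iso_def ring_hom_def)

lemma \<alpha>_scalar: "\<alpha> (Poly_Mapping.single 0 c) = Poly_Mapping.single 0 c"
proof -
  have "\<alpha> (c \<odot>\<^bsub>laurent2_alg\<^esub> 1) = c \<odot>\<^bsub>laurent2_alg\<^esub> \<alpha> 1"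
    using \<alpha>_iso by (simp add: alg_iso_def del: monoid_alg_simps(6))
  then show ?thesis by (simp add: \<alpha>_1)
qed

lemma \<alpha>_single: "\<alpha> (Poly_Mapping.single (b, l) c) = Poly_Mapping.single (b, l + b) c"
proof -
  have y: "\<alpha> (Poly_Mapping.single (b, 0) 1) = Poly_Mapping.single (b, b) 1"
    by (rule int_hom_unique[where F = "\<lambda>b. \<alpha> (Poly_Mapping.single (b, 0) 1)"
          and G = "\<lambda>b. Poly_Mapping.single (b, b) 1"])
      (use \<alpha>_y in \<open>simp_all add: mult_single \<alpha>_1 y_L_def Q_L_def flip: \<alpha>_mult zero_prod_def\<close>)
  have Q: "\<alpha> (Poly_Mapping.single (0, l) 1) = Poly_Mapping.single (0, l) 1"
    by (rule int_hom_unique[where F = "\<lambda>l. \<alpha> (Poly_Mapping.single (0, l) 1)"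
          and G = "\<lambda>l. Poly_Mapping.single (0, l) 1"])
      (use \<alpha>_Q in \<open>simp_all add: mult_single \<alpha>_1 Q_L_def flip: \<alpha>_mult zero_prod_def\<close>)
  have "Poly_Mapping.single (b, l) c =
      Poly_Mapping.single 0 c * (Poly_Mapping.single (b, 0) 1 * Poly_Mapping.single (0, l) 1)"
    by (simp add: mult_single)
  then show ?thesis
    by (simp add: \<alpha>_scalar \<alpha>_mult y Q) (simp add: mult_single add.commute)
qed

text \<open>Injectivity of \<alpha> lets downward induction steps be checked after one more
  application of \<alpha>, without handling its inverse.\<close>

lemma int_iter_\<alpha>_minus1: "int_iter \<alpha> (i - 1) p = q \<longleftrightarrow> int_iter \<alpha> i p = \<alpha> q"
  using int_iter_plus1[OF bij_\<alpha>, of "i - 1" p] bij_\<alpha> by (simp add: bij_def inj_eq)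

lemma int_iter_\<alpha>_add: "int_iter \<alpha> i (p + q) = int_iter \<alpha> i p + int_iter \<alpha> i q"
proof (induction i rule: int_induct[of _ 0])
  case (step2 i)
  then show ?case
    using int_iter_plus1[OF bij_\<alpha>, of "i - 1"] by (simp add: int_iter_\<alpha>_minus1 \<alpha>_add)
qed (simp_all add: int_iter_plus1 bij_\<alpha> \<alpha>_add)

lemma int_iter_\<alpha>_0: "int_iter \<alpha> i 0 = 0"
  using int_iter_\<alpha>_add[of i 0 0] by simp

lemma int_iter_\<alpha>_single:
  "int_iter \<alpha> i (Poly_Mapping.single (b, l) c) = Poly_Mapping.single (b, l + i * b) c"
proof (induction i rule: int_induct[of _ 0])
  case (step2 i)
  then show ?case
    by (simp add: int_iter_\<alpha>_minus1 \<alpha>_single algebra_simps)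
qed (simp_all add: int_iter_plus1 bij_\<alpha> \<alpha>_single algebra_simps)

end

section \<open>From the skew Laurent ring to the twisted group algebra\<close>

definition flatten :: "(int \<Rightarrow>\<^sub>0 'k::field laurent2) \<Rightarrow> 'k torus" where
  "flatten s = Abs_poly_mapping (\<lambda>u. case u of Mon a k i \<Rightarrow>
     Poly_Mapping.lookup (Poly_Mapping.lookup s i) (a, k))"

lemma lookup_flatten:
  "Poly_Mapping.lookup (flatten s) (Mon a k i) = Poly_Mapping.lookup (Poly_Mapping.lookup s i) (a, k)"
proof -
  let ?f = "\<lambda>u. case u of Mon a k i \<Rightarrow> Poly_Mapping.lookup (Poly_Mapping.lookup s i) (a, k)"
  \<comment> \<open>\<open>Abs_poly_mapping\<close> can be evaluated only for finite support, which
    here lies in the image of a finite dependent sum.\<close>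
  have "{u. ?f u \<noteq> 0} \<subseteq> (\<lambda>(i, a, k). Mon a k i) `
      (SIGMA i:Poly_Mapping.keys s. Poly_Mapping.keys (Poly_Mapping.lookup s i))"
  proof
    fix u
    assume u: "u \<in> {u. ?f u \<noteq> 0}"
    obtain a k i where "u = Mon a k i" by (cases u)
    with u show "u \<in> (\<lambda>(i, a, k). Mon a k i) `
        (SIGMA i:Poly_Mapping.keys s. Poly_Mapping.keys (Poly_Mapping.lookup s i))"
      by (intro image_eqI[of _ _ "(i, a, k)"]) (auto simp: in_keys_iff)
  qed
  then have "finite {u. ?f u \<noteq> 0}"
    by (rule finite_subset) auto
  then show ?thesis by (simp add: flatten_def)
qed

lemma flatten_eqI:
  "(\<And>a k i. Poly_Mapping.lookup s (Mon a k i) = Poly_Mapping.lookup t (Mon a k i)) \<Longrightarrow> s = t"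
  by (rule poly_mapping_eqI) (metis torus_monomial.exhaust)

lemma flatten_add: "flatten (s + t) = flatten s + flatten t"
  by (rule flatten_eqI) (simp add: lookup_flatten lookup_add)

lemma flatten_single:
  "flatten (Poly_Mapping.single i (Poly_Mapping.single (a, k) c)) = Poly_Mapping.single (Mon a k i) c"
  by (rule flatten_eqI) (auto simp: lookup_flatten lookup_single when_def)

lemma inj_flatten: "inj flatten"
proof (rule injI)
  fix s t :: "int \<Rightarrow>\<^sub>0 'k::field laurent2"
  assume "flatten s = flatten t"
  then have "Poly_Mapping.lookup (Poly_Mapping.lookup s i) (a, k) =
      Poly_Mapping.lookup (Poly_Mapping.lookup t i) (a, k)" for a k i
    by (simp flip: lookup_flatten)
  then show "s = t" by (intro poly_mapping_eqI) auto
qed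

lemma surj_flatten: "surj flatten"
proof -
  have "t \<in> range flatten" for t :: "'k::field torus"
  proof (induction t rule: poly_mapping_add_induct)
    case zero
    show ?case using flatten_single[of 0 0 0 0] by (metis rangeI single_zero)
  next
    case (single u c)
    show ?case by (cases u) (metis flatten_single rangeI)
  next
    case (add s t)
    then obtain s' t' where "s = flatten s'" "t = flatten t'" by auto
    then have "s + t = flatten (s' + t')" by (simp add: flatten_add)
    then show ?case by (rule range_eqI)
  qed
  then show ?thesis by auto
qed

lemma skew_additive_eqI:
  fixes F G :: "(int \<Rightarrow>\<^sub>0 'k::field laurent2) \<Rightarrow> 'c::ab_group_add"
  assumes F: "\<And>f g. F (f + g) = F f + F g" and G: "\<And>f g. G (f + g) = G f + G g"
    and single: "\<And>i a k c. F (Poly_Mapping.single i (Poly_Mapping.single (a, k) c)) =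
      G (Poly_Mapping.single i (Poly_Mapping.single (a, k) c))"
  shows "F s = G s"
proof (rule additive_eqI[where f = s and F = F and G = G])
  fix i and p :: "'k laurent2"
  show "F (Poly_Mapping.single i p) = G (Poly_Mapping.single i p)"
  proof (rule additive_eqI[where f = p and F = "\<lambda>p. F (Poly_Mapping.single i p)"
        and G = "\<lambda>p. G (Poly_Mapping.single i p)"])
    fix ak and c :: 'k
    show "F (Poly_Mapping.single i (Poly_Mapping.single ak c)) =
        G (Poly_Mapping.single i (Poly_Mapping.single ak c))"
      by (cases ak) (simp add: single)
  qed (simp_all add: single_add F G)
qed (fact F G)+

text \<open>Both products are biadditive. On monomials, \<alpha>^i turns y^b into Q^(ib) y^b, which
  is the twist built into the addition of \<open>torus_monomial\<close>.\<close>

lemma (in torus_automorphism) flatten_mult: "flatten (skew_mult \<alpha> s t) = flatten s * flatten t"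
proof -
  note add = skew_mult_add_left[of \<alpha>, OF int_iter_\<alpha>_0] skew_mult_add_right[of \<alpha>, OF int_iter_\<alpha>_add]
  have single: "flatten (skew_mult \<alpha> (Poly_Mapping.single i (Poly_Mapping.single (a, k) c)) t) =
      flatten (Poly_Mapping.single i (Poly_Mapping.single (a, k) c)) * flatten t" for i a k c
    by (rule skew_additive_eqI[where s = t
          and F = "\<lambda>t. flatten (skew_mult \<alpha> (Poly_Mapping.single i (Poly_Mapping.single (a, k) c)) t)"
          and G = "\<lambda>t. flatten (Poly_Mapping.single i (Poly_Mapping.single (a, k) c)) * flatten t"])
      (simp_all add: add flatten_add distrib_left skew_mult_single int_iter_\<alpha>_0 int_iter_\<alpha>_single
        mult_single flatten_single add.assoc)
  show ?thesis
    by (rule skew_additive_eqI[where s = s and F = "\<lambda>s. flatten (skew_mult \<alpha> s t)"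
          and G = "\<lambda>s. flatten s * flatten t"])
      (simp_all add: add flatten_add distrib_right single)
qed

lemma flatten_1: "flatten 1 = 1"
  using flatten_single[of 0 0 0 "1 :: 'a"]
  by (simp flip: zero_prod_def zero_torus_monomial_def)

lemma flatten_smult:
  "flatten (Poly_Mapping.map (\<lambda>p. Poly_Mapping.single 0 c * p) s) = Poly_Mapping.single 0 c * flatten s"
proof -
  have lookup: "Poly_Mapping.lookup (Poly_Mapping.map (\<lambda>p. Poly_Mapping.single 0 c * p) s) i =
      Poly_Mapping.single 0 c * Poly_Mapping.lookup s i" for s :: "int \<Rightarrow>\<^sub>0 'a laurent2" and i
    by (simp add: Poly_Mapping.map.rep_eq when_def)
  have add: "Poly_Mapping.map (\<lambda>p. Poly_Mapping.single 0 c * p) (s + t) =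
      Poly_Mapping.map (\<lambda>p. Poly_Mapping.single 0 c * p) s +
      Poly_Mapping.map (\<lambda>p. Poly_Mapping.single 0 c * p) t" for s t :: "int \<Rightarrow>\<^sub>0 'a laurent2"
    by (rule poly_mapping_eqI) (simp add: lookup lookup_add distrib_left)
  show ?thesis
    by (rule skew_additive_eqI[where s = s
          and F = "\<lambda>s. flatten (Poly_Mapping.map (\<lambda>p. Poly_Mapping.single 0 c * p) s)"
          and G = "\<lambda>s. Poly_Mapping.single 0 c * flatten s"])
      (simp_all add: add flatten_add distrib_left mult_single flatten_single)
qed

lemma quantum_torus_simps [simp]:
  "carrier (quantum_torus \<alpha>) = UNIV" "x \<otimes>\<^bsub>quantum_torus \<alpha>\<^esub> y = skew_mult \<alpha> x y"
  "\<one>\<^bsub>quantum_torus \<alpha>\<^esub> = 1" "x \<oplus>\<^bsub>quantum_torus \<alpha>\<^esub> y = x + y"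
  "c \<odot>\<^bsub>quantum_torus \<alpha>\<^esub> x = Poly_Mapping.map (\<lambda>p. Poly_Mapping.single 0 c * p) x"
proof -
  have "smult laurent2_alg c = (\<lambda>p. Poly_Mapping.single 0 c * p)"
    by (rule ext) simp
  then show "c \<odot>\<^bsub>quantum_torus \<alpha>\<^esub> x = Poly_Mapping.map (\<lambda>p. Poly_Mapping.single 0 c * p) x"
    by (simp add: quantum_torus_def skew_laurent_alg_def)
qed (simp_all add: quantum_torus_def skew_laurent_alg_def)

section \<open>The involution and its fixed points\<close>

locale torus_involution = torus_automorphism \<alpha> for \<alpha> :: "'k::field laurent2 \<Rightarrow> 'k laurent2" +
  fixes \<theta> :: "(int \<Rightarrow>\<^sub>0 'k laurent2) \<Rightarrow> (int \<Rightarrow>\<^sub>0 'k laurent2)"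
  assumes \<theta>_iso: "\<theta> \<in> alg_iso (quantum_torus \<alpha>) (quantum_torus \<alpha>)"
    and \<theta>_x: "\<theta> x_S = x_inv_S" and \<theta>_y: "\<theta> y_S = y_inv_S" and \<theta>_Q: "\<theta> Q_S = Q_S"
begin

definition \<rho> :: "'k torus \<Rightarrow> 'k torus" where
  "\<rho> t = flatten (\<theta> (inv_into UNIV flatten t))"

lemma \<rho>_flatten: "\<rho> (flatten s) = flatten (\<theta> s)"
  by (simp add: \<rho>_def inj_flatten)

lemma \<theta>_add: "\<theta> (s + t) = \<theta> s + \<theta> t"
  and \<theta>_mult: "\<theta> (skew_mult \<alpha> s t) = skew_mult \<alpha> (\<theta> s) (\<theta> t)"
  and \<theta>_1: "\<theta> 1 = 1"
  and \<theta>_smult: "\<theta> (Poly_Mapping.map (\<lambda>p. Poly_Mapping.single 0 c * p) s) =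
    Poly_Mapping.map (\<lambda>p. Poly_Mapping.single 0 c * p) (\<theta> s)"
  using \<theta>_iso by (simp_all add: alg_iso_def ring_iso_def ring_hom_def)

lemma obtain_flatten: obtains s where "t = flatten s"
  using surj_flatten by (metis surjD)

lemma \<rho>_add: "\<rho> (s + t) = \<rho> s + \<rho> t"
  by (rule obtain_flatten[of s], rule obtain_flatten[of t]) (metis \<rho>_flatten \<theta>_add flatten_add)

lemma \<rho>_mult: "\<rho> (s * t) = \<rho> s * \<rho> t"
  by (rule obtain_flatten[of s], rule obtain_flatten[of t]) (metis \<rho>_flatten \<theta>_mult flatten_mult)

lemma \<rho>_scalar: "\<rho> (Poly_Mapping.single 0 c * t) = Poly_Mapping.single 0 c * \<rho> t"
  by (rule obtain_flatten[of t]) (metis \<rho>_flatten \<theta>_smult flatten_smult)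

lemma \<rho>_1: "\<rho> 1 = 1"
  by (metis \<theta>_1 flatten_1 \<rho>_flatten)

lemma \<rho>_mon: "\<rho> (mon a k i) = mon (- a) k (- i)"
proof -
  have x: "\<rho> (mon 0 0 1) = mon 0 0 (- 1)"
    using arg_cong[OF \<theta>_x, of flatten]
    by (simp add: x_S_def x_inv_S_def mon_def zero_prod_def flatten_single
        flip: \<rho>_flatten single_one)
  have y: "\<rho> (mon 1 0 0) = mon (- 1) 0 0"
    using arg_cong[OF \<theta>_y, of flatten]
    by (simp add: y_S_def y_inv_S_def y_L_def y_inv_L_def mon_def flatten_single flip: \<rho>_flatten)
  have Q: "\<rho> (mon 0 1 0) = mon 0 1 0"
    using arg_cong[OF \<theta>_Q, of flatten]
    by (simp add: Q_S_def Q_L_def mon_def flatten_single flip: \<rho>_flatten)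
  have x_pow: "\<rho> (mon 0 0 i) = mon 0 0 (- i)"
    by (rule int_hom_unique[where F = "\<lambda>i. \<rho> (mon 0 0 i)" and G = "\<lambda>i. mon 0 0 (- i)"])
      (simp_all add: mon_mult mon_0 \<rho>_1 x flip: \<rho>_mult)
  have y_pow: "\<rho> (mon a 0 0) = mon (- a) 0 0"
    by (rule int_hom_unique[where F = "\<lambda>a. \<rho> (mon a 0 0)" and G = "\<lambda>a. mon (- a) 0 0"])
      (simp_all add: mon_mult mon_0 \<rho>_1 y flip: \<rho>_mult)
  have Q_pow: "\<rho> (mon 0 k 0) = mon 0 k 0"
    by (rule int_hom_unique[where F = "\<lambda>k. \<rho> (mon 0 k 0)" and G = "\<lambda>k. mon 0 k 0"])
      (simp_all add: mon_mult mon_0 \<rho>_1 Q flip: \<rho>_mult)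
  \<comment> \<open>The factors are in normal order, so their product has no twist, before and after
    applying \<open>\<rho>\<close>.\<close>
  have "\<rho> (mon a k i) = \<rho> (mon a 0 0) * \<rho> (mon 0 k 0) * \<rho> (mon 0 0 i)"
    by (simp add: mon_mult flip: \<rho>_mult)
  then show ?thesis by (simp add: x_pow y_pow Q_pow mon_mult)
qed

lemma \<rho>_single: "\<rho> (Poly_Mapping.single u c) = Poly_Mapping.single (rev_mon u) c"
proof -
  obtain a k i where u: "u = Mon a k i" by (cases u)
  have "Poly_Mapping.single (Mon a k i) c = Poly_Mapping.single 0 c * mon a k i" for a k i
    by (simp add: mon_def mult_single)
  then show ?thesis by (simp add: u \<rho>_scalar \<rho>_mon)
qed

lemma \<rho>_\<phi>: "\<rho> (\<phi> f) = \<phi> f"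
proof (induction f rule: free_alg_induct)
  case (scalar c)
  show ?case using \<rho>_scalar[of c 1] by (simp add: \<phi>_scalar \<rho>_1)
next
  case (var v f)
  have "\<rho> (torus_gen v) = torus_gen v" by (cases v) (simp_all add: \<rho>_add \<rho>_mon add.commute)
  with var show ?case by (simp add: \<phi>_mult \<phi>_var \<rho>_mult)
next
  case (add f h)
  then show ?case by (simp add: \<phi>_add \<rho>_add)
qed

lemma range_\<phi>:
  assumes 2: "(2 :: 'k) \<noteq> 0"
  shows "range \<phi> = {t. \<rho> t = t}"
proof
  show "range \<phi> \<subseteq> {t. \<rho> t = t}" by (auto simp: \<rho>_\<phi>)
  show "{t. \<rho> t = t} \<subseteq> range \<phi>"
  proof
    fix t
    assume "t \<in> {t. \<rho> t = t}"
    then have "\<phi>\<^sub>T (\<psi> t) = Poly_Mapping.single 0 (inverse 2) * (t + t)"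
      using \<phi>\<^sub>T_\<psi>[OF 2, of \<rho> t] by (simp add: \<rho>_add \<rho>_single)
    also have "\<dots> = Poly_Mapping.single 0 (inverse 2 * 2) * t"
      by (simp only: mult_2_right distrib_left distrib_right single_add)
    also have "\<dots> = t" using 2 by simp
    \<comment> \<open>A preimage is any representative of \<open>\<psi> t\<close> in the free
      algebra.\<close>
    finally show "t \<in> range \<phi>" by (metis \<phi>\<^sub>T_\<pi> \<pi>_surj rangeI)
  qed
qed

end


section \<open>The isomorphism\<close>

text \<open>Describes the cosets as fibres of \<open>\<pi>\<close>, so that computations in
  \<open>T_alg\<close> reduce to computations in the type \<open>T\<close>.\<close>

lemma T_class_eq: "T_class f = {h. \<pi> h = \<pi> f}"
proof -
  have "h \<in> T_class f \<longleftrightarrow> h - f \<in> T_ideal" for h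
    by (auto simp: T_class_def a_r_coset_def' intro: bexI[of _ "h - f"])
  then show ?thesis by (auto simp: \<pi>_eq_iff)
qed

lemma T_class_eq_iff: "T_class f = T_class h \<longleftrightarrow> \<pi> f = \<pi> h"
  by (auto simp: T_class_eq)

lemma T_alg_carrier: "carrier T_alg = range T_class"
  by (auto simp: T_alg_def presented_alg_def quot_alg_def FactRing_def A_RCOSETS_def' T_class_def)

lemma T_alg_mult: "T_class f \<otimes>\<^bsub>T_alg\<^esub> T_class h = T_class (f * h)"
  using ideal.rcoset_mult_add[OF T_ideal_ideal, of f h]
  by (simp add: T_alg_def presented_alg_def quot_alg_def FactRing_def T_class_def)

lemma T_alg_one: "\<one>\<^bsub>T_alg\<^esub> = T_class 1"
  by (simp add: T_alg_def presented_alg_def quot_alg_def FactRing_def T_class_def)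

lemma T_alg_add: "T_class f \<oplus>\<^bsub>T_alg\<^esub> T_class h = T_class (f + h)"
proof -
  have "T_class f \<oplus>\<^bsub>T_alg\<^esub> T_class h = {a + b | a b. a \<in> T_class f \<and> b \<in> T_class h}"
    by (auto simp: T_alg_def presented_alg_def quot_alg_def FactRing_def set_add_def')
  also have "\<dots> = T_class (f + h)"
  proof
    show "T_class (f + h) \<subseteq> {a + b | a b. a \<in> T_class f \<and> b \<in> T_class h}"
    proof
      fix x
      assume "x \<in> T_class (f + h)"
      then have "f \<in> T_class f" "x - f \<in> T_class h" by (simp_all add: T_class_eq \<pi>_diff \<pi>_add)
      then show "x \<in> {a + b | a b. a \<in> T_class f \<and> b \<in> T_class h}"
        by (intro CollectI exI[of _ f] exI[of _ "x - f"]) simp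
    qed
  qed (auto simp: T_class_eq \<pi>_add)
  finally show ?thesis .
qed

lemma T_alg_smult: "c \<odot>\<^bsub>T_alg\<^esub> T_class f = T_class (Poly_Mapping.single 0 c * f)"
proof -
  have "c \<odot>\<^bsub>T_alg\<^esub> T_class f = (\<Union>a\<in>T_class f. T_class (Poly_Mapping.single 0 c * a))"
    by (simp add: T_alg_def presented_alg_def quot_alg_def T_class_def)
  also have "\<dots> = T_class (Poly_Mapping.single 0 c * f)"
    by (auto simp: T_class_eq \<pi>_mult)
  finally show ?thesis .
qed

section \<open>The quotient of T by g\<close>

definition g_poly :: "(T_gen, 'k::field) free_alg" where
  "g_poly = var GX3 * var GX2 * var GX1 - var GQ * (var GX3)\<^sup>2 - (var GQinv)\<^sup>2 * (var GX2)\<^sup>2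
      - (var GX1)\<^sup>2 + 2 * (1 + (var GQinv)\<^sup>2)"

lemma \<pi>_g_poly: "\<pi> g_poly = T.g"
  by (simp add: T_g_eq g_poly_def)

lemma g_T_eq: "g_T = T_class g_poly"
  by (simp add: g_T_def g_poly_def Let_def)

lemma g_T_central:
  assumes "t \<in> carrier T_alg"
  shows "g_T \<otimes>\<^bsub>T_alg\<^esub> t = t \<otimes>\<^bsub>T_alg\<^esub> g_T"
proof -
  obtain f where "t = T_class f" using assms by (auto simp: T_alg_carrier)
  then show ?thesis
    by (simp add: g_T_eq T_alg_mult T_class_eq_iff \<pi>_mult \<pi>_g_poly T_g_central)
qed

text \<open>An element of T/gT is a set of cosets. It is indexed here by the common image of their
  representatives in the torus, so no representative has to be chosen.\<close>

definition \<phi>_fibre :: "'k::field torus \<Rightarrow> (T_gen, 'k) free_alg set set" where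
  "\<phi>_fibre t = T_class ` {f. \<phi> f = t}"

text \<open>This is the kernel computation in terms of cosets: \<open>e\<close> and \<open>f\<close>
  have the same image under \<open>\<phi>\<close> exactly when their classes in \<open>T\<close>
  differ by a multiple of \<open>g\<close>.\<close>

lemma coset_gT:
  assumes 2: "(2 :: 'k::field) \<noteq> 0"
  shows "gT +>\<^bsub>T_alg\<^esub> T_class (f :: (T_gen, 'k) free_alg) = \<phi>_fibre (\<phi> f)"
proof -
  have gT: "(gT :: (T_gen, 'k) free_alg set set) = range (\<lambda>h. T_class (g_poly * h))"
    by (auto simp: gT_def T_alg_carrier g_T_eq simp flip: T_alg_mult)
  have "gT +>\<^bsub>T_alg\<^esub> T_class f = {T_class (g_poly * h + f) | h. True}"
    unfolding a_r_coset_def' gT by (auto simp: T_alg_add)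
  also have "\<dots> = \<phi>_fibre (\<phi> f)"
  proof
    have "\<phi> g_poly = (0 :: 'k torus)" by (metis \<phi>\<^sub>T_\<pi> \<phi>\<^sub>T_g \<pi>_g_poly)
    then show "{T_class (g_poly * h + f) | h. True} \<subseteq> \<phi>_fibre (\<phi> f)"
      by (auto simp: \<phi>_fibre_def \<phi>_add \<phi>_mult)
    show "\<phi>_fibre (\<phi> f) \<subseteq> {T_class (g_poly * h + f) | h. True}"
    proof
      fix X
      assume "X \<in> \<phi>_fibre (\<phi> f)"
      then obtain e where e: "\<phi> e = \<phi> f" "X = T_class e" by (auto simp: \<phi>_fibre_def)
      then have "\<pi> (e - f) \<in> T.gI" by (simp add: \<phi>_diff flip: \<phi>_eq_0_iff[OF 2])
      then obtain t where "\<pi> (e - f) = T.g * t" by (auto simp: T.gI_def)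
      moreover obtain h where "t = \<pi> h" using \<pi>_surj by blast
      ultimately have "\<pi> e = \<pi> (g_poly * h + f)"
        by (simp add: \<pi>_add \<pi>_mult \<pi>_diff \<pi>_g_poly algebra_simps)
      then show "X \<in> {T_class (g_poly * h + f) | h. True}" using e by (auto simp: T_class_eq_iff)
    qed
  qed
  finally show ?thesis .
qed

text \<open>One of the two points is taken in the range of \<open>\<phi>\<close>, since fibres over
  points outside it are empty and hence all equal.\<close>

lemma \<phi>_fibre_inj:
  assumes "\<phi>_fibre (\<phi> f) = \<phi>_fibre t"
  shows "\<phi> f = t"
proof -
  have "T_class f \<in> \<phi>_fibre t" using assms by (auto simp: \<phi>_fibre_def)
  then show ?thesis by (auto simp: \<phi>_fibre_def T_class_eq_iff) (metis \<phi>\<^sub>T_\<pi>)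
qed

context
  fixes A :: "('k::field, (T_gen, 'k) free_alg set set) module"
  defines "A \<equiv> quot_alg T_alg gT"
  assumes 2: "(2 :: 'k) \<noteq> 0"
begin

lemma quot_carrier: "carrier A = \<phi>_fibre ` range \<phi>"
  by (auto simp: A_def quot_alg_def FactRing_def A_RCOSETS_def' T_alg_carrier coset_gT[OF 2])

lemma quot_one: "\<one>\<^bsub>A\<^esub> = \<phi>_fibre 1"
  using coset_gT[OF 2, of 1] by (simp add: A_def quot_alg_def FactRing_def T_alg_one)

lemma quot_mult: "\<phi>_fibre (\<phi> f) \<otimes>\<^bsub>A\<^esub> \<phi>_fibre (\<phi> h) = \<phi>_fibre (\<phi> f * \<phi> h)"
  by (auto simp: A_def quot_alg_def FactRing_def rcoset_mult_def T_alg_mult coset_gT[OF 2] \<phi>_mult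
      \<phi>_fibre_def[of "\<phi> f"] \<phi>_fibre_def[of "\<phi> h"])

lemma quot_smult: "c \<odot>\<^bsub>A\<^esub> \<phi>_fibre (\<phi> f) = \<phi>_fibre (Poly_Mapping.single 0 c * \<phi> f)"
  by (auto simp: A_def quot_alg_def T_alg_smult coset_gT[OF 2] \<phi>_mult \<phi>_scalar \<phi>_fibre_def[of "\<phi> f"])

lemma quot_add: "\<phi>_fibre (\<phi> f) \<oplus>\<^bsub>A\<^esub> \<phi>_fibre (\<phi> h) = \<phi>_fibre (\<phi> f + \<phi> h)"
proof -
  have "\<phi>_fibre (\<phi> f) \<oplus>\<^bsub>A\<^esub> \<phi>_fibre (\<phi> h) =
      {T_class (a + b) | a b. \<phi> a = \<phi> f \<and> \<phi> b = \<phi> h}"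
    by (auto simp: A_def quot_alg_def FactRing_def set_add_def' \<phi>_fibre_def T_alg_add)
  also have "\<dots> = \<phi>_fibre (\<phi> f + \<phi> h)"
  proof
    show "\<phi>_fibre (\<phi> f + \<phi> h) \<subseteq> {T_class (a + b) | a b. \<phi> a = \<phi> f \<and> \<phi> b = \<phi> h}"
    proof
      fix X
      assume "X \<in> \<phi>_fibre (\<phi> f + \<phi> h)"
      then obtain e where "\<phi> e = \<phi> f + \<phi> h" "X = T_class e" by (auto simp: \<phi>_fibre_def)
      then show "X \<in> {T_class (a + b) | a b. \<phi> a = \<phi> f \<and> \<phi> b = \<phi> h}"
        by (intro CollectI exI[of _ f] exI[of _ "e - f"]) (simp add: \<phi>_diff)
    qed
  qed (auto simp: \<phi>_fibre_def \<phi>_add)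
  finally show ?thesis .
qed

end

lemma fixed_alg_simps [simp]:
  "carrier (fixed_alg A \<theta>) = {a \<in> carrier A. \<theta> a = a}" "mult (fixed_alg A \<theta>) = mult A"
  "one (fixed_alg A \<theta>) = one A" "add (fixed_alg A \<theta>) = add A" "smult (fixed_alg A \<theta>) = smult A"
  by (simp_all add: fixed_alg_def)

text \<open>This is the inverse of the map from T/gT induced by \<open>\<phi>\<close>. In this
  direction the map is given by a formula and nothing has to be shown well defined on
  cosets.\<close>

lemma (in torus_involution) fixed_iso:
  assumes 2: "(2 :: 'k) \<noteq> 0"
  shows "(\<lambda>s. \<phi>_fibre (flatten s)) \<in> alg_iso (fixed_alg (quantum_torus \<alpha>) \<theta>) (quot_alg T_alg gT)"
proof -
  \<comment> \<open>By \<open>range_\<phi>\<close>, flattening identifies the fixed ring with the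
    image of \<open>\<phi>\<close>, which also indexes the carrier of the quotient.\<close>
  have fixed: "\<theta> s = s \<longleftrightarrow> flatten s \<in> range \<phi>" for s
    unfolding range_\<phi>[OF 2] by (simp add: \<rho>_flatten inj_eq[OF inj_flatten])
  note quot = quot_carrier[OF 2] quot_one[OF 2] quot_mult[OF 2] quot_add[OF 2] quot_smult[OF 2]
  have "bij_betw (\<lambda>s. \<phi>_fibre (flatten s)) {s. flatten s \<in> range \<phi>} (\<phi>_fibre ` range \<phi>)"
  proof (rule bij_betw_imageI)
    show "inj_on (\<lambda>s. \<phi>_fibre (flatten s)) {s. flatten s \<in> range \<phi>}"
    proof (rule inj_onI)
      fix s t
      assume "s \<in> {s. flatten s \<in> range \<phi>}" "\<phi>_fibre (flatten s) = \<phi>_fibre (flatten t)"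
      then have "flatten s = flatten t" by (auto dest: \<phi>_fibre_inj)
      then show "s = t" by (rule injD[OF inj_flatten])
    qed
    have "flatten ` {s. flatten s \<in> range \<phi>} = range \<phi>"
      using surj_image_vimage_eq[OF surj_flatten, of "range \<phi>"] by (simp add: vimage_def)
    then show "(\<lambda>s. \<phi>_fibre (flatten s)) ` {s. flatten s \<in> range \<phi>} = \<phi>_fibre ` range \<phi>"
      by (metis image_image)
  qed
  then show ?thesis
    by (auto simp: alg_iso_def ring_iso_def ring_hom_def fixed quot flatten_mult flatten_add flatten_1
        flatten_smult)
qed

theorem proposition6p5:
  fixes \<alpha> :: "'k::field laurent2 \<Rightarrow> 'k laurent2"
    and \<theta> :: "(int \<Rightarrow>\<^sub>0 'k laurent2) \<Rightarrow> (int \<Rightarrow>\<^sub>0 'k laurent2)"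
  assumes "CHAR('k) \<noteq> 2"
    and "\<alpha> \<in> alg_iso laurent2_alg laurent2_alg"
    and "\<alpha> y_L = Q_L * y_L" and "\<alpha> Q_L = Q_L"
    and "\<theta> \<in> alg_iso (quantum_torus \<alpha>) (quantum_torus \<alpha>)"
    and "\<theta> x_S = x_inv_S" and "\<theta> y_S = y_inv_S" and "\<theta> Q_S = Q_S"
  shows "(\<forall>t\<in>carrier (T_alg :: ('k, (T_gen, 'k) free_alg set) module).
            g_T \<otimes>\<^bsub>T_alg\<^esub> t = t \<otimes>\<^bsub>T_alg\<^esub> g_T) \<and>
         alg_iso (fixed_alg (quantum_torus \<alpha>) \<theta>) (quot_alg T_alg gT) \<noteq> {}"
proof -
  interpret torus_involution \<alpha> \<theta>
    by unfold_locales (fact assms)+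
  have "(2 :: 'k) \<noteq> 0"
  proof
    assume "(2 :: 'k) = 0"
    then have "CHAR('k) dvd 2" using of_nat_eq_0_iff_char_dvd[of 2, where 'a = 'k] by simp
    then have "CHAR('k) \<le> 2" "CHAR('k) \<noteq> 0"
      by (simp add: dvd_imp_le, metis dvd_0_left_iff zero_neq_numeral)
    moreover have "CHAR('k) \<noteq> 1" using of_nat_CHAR[where 'a = 'k] by auto
    ultimately show False using assms(1) by linarith
  qed
  then show ?thesis using g_T_central fixed_iso by blast
qed

end
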